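(* The $120$-cell $C$, defined as the convex hull in $\mathbb{H} \cong \mathbb{R}^4$ of the vertices of the Voronoi tiling $\mathcal{T}_{120}$ of $S^3$ determined by the binary dodecahedral group $\mathcal{D}^*$, is a regular polytope.
   Context: Let $\mathbb{H} = \mathbb{R} \oplus \mathbb{I}$ be the quaternions, identified with $\mathbb{R}^4$ with orthonormal basis $1, i, j, k$, where $\mathbb{I} = i\mathbb{R} \oplus j\mathbb{R} \oplus k\mathbb{R} \cong \mathbb{R}^3$ is the subspace of purely imaginary quaternions. Let $S^3 = \{q \in \mathbb{H} : |q| = 1\}$ be the group of unit quaternions, with metric $d_S(p,q) = \arccos \langle p, q\rangle$. For $q \in S^3$ let $\psi_q \in \mathrm{SO}(3) = \mathrm{Isom}^+_0(\mathbb{I})$ (the orientation-preserving isometries of $\mathbb{I}$ fixing the origin) be $\psi_q(p) = q p q^{-1}$; the map $\psi : S^3 \to \mathrm{SO}(3)$, $q \mapsto \psi_q$, is a two-to-one homomorphism. Set $x = \frac{1}{2}(\cot \frac{\pi}{5} + \cot \frac{2\pi}{5})$ and $y = \frac{1}{2}(\cot \frac{\pi}{5} - \cot \frac{2\pi}{5})$, so $x^2 + y^2 = 1$. Let $D \subset \mathbb{I}$ be the regular dodecahedron with vertices on the unit sphere of $\mathbb{I}$, positioned so that its twelve face centres lie in the directions $\pm x i \pm y j$, $\pm x j \pm y k$, $\pm y i \pm x k$ (all sign choices); it has a vertex at $\frac{1}{\sqrt 3}(i+j+k)$. Let $\mathcal{D} \subset \mathrm{SO}(3)$ be the group (of order 60)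 of orientation-preserving symmetries of $D$, and let $\mathcal{D}^* = \psi^{-1}(\mathcal{D}) \subset S^3$ be the binary dodecahedral group (of order 120). For $q \in \mathcal{D}^*$ define $\mathrm{Vor}(q) = \{ r \in S^3 : d_S(q,r) \le d_S(p,r) \text{ for all } p \in \mathcal{D}^*\}$. The tiling $\mathcal{T}_{120}$ of $S^3$ is the one with three-cells $\{\mathrm{Vor}(q) : q \in \mathcal{D}^*\}$; its vertices are the vertices of these spherical polyhedra. A polytope is the convex hull of a finite set of points. A face of a polytope $P$ (other than $P$ itself) is the intersection of $P$ with a supporting hyperplane in the affine span of $P$. A flag of a $k$-dimensional polytope $P$ is a chain of faces $Q_0 \subset Q_1 \subset \dots \subset Q_{k-1} \subset Q_k = P$ with $\dim Q_\ell = \ell$. $\mathrm{Sym}(P)$ is the group of isometries (rigid motions and reflections) of the affine span of $P$ preserving $P$ setwise. $P$ is regular if for any two flags $F, G$ of $P$ there is $\phi \in \mathrm{Sym}(P)$ with $\phi(F) = G$. *)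

theory Defs
  imports "HOL-Analysis.Analysis"
begin

subsection \<open>Quaternions\<close>

text \<open>
  A quaternion \<open>a + v\<close> with real part \<open>a\<close> and imaginary part
  \<open>v = v$1 i + v$2 j + v$3 k\<close> is the pair \<open>(a, v)\<close>. The inner product of the product type is
  the one of \<open>\<real>\<^sup>4\<close> in which 1, i, j, k are orthonormal.
\<close>

type_synonym quat = "real \<times> (real^3)"

definition quat_mult :: "quat \<Rightarrow> quat \<Rightarrow> quat" (infixl \<open>\<cdot>\<^sub>H\<close> 70) where
  "p \<cdot>\<^sub>H q = (fst p * fst q - snd p \<bullet> snd q,
             fst p *\<^sub>R snd q + fst q *\<^sub>R snd p + cross3 (snd p) (snd q))"

definition quat_inverse :: "quat \<Rightarrow> quat" where
  "quat_inverse q = (1 / (norm q)\<^sup>2) *\<^sub>R (fst q, - snd q)"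

lemma quat_mult_units:
  defines "i \<equiv> (0, axis 1 1) :: quat" and "j \<equiv> (0, axis 2 1) :: quat"
    and "k \<equiv> (0, axis 3 1) :: quat"
  shows "i \<cdot>\<^sub>H j = k" "j \<cdot>\<^sub>H k = i" "k \<cdot>\<^sub>H i = j"
    "i \<cdot>\<^sub>H i = (-1, 0)" "j \<cdot>\<^sub>H j = (-1, 0)" "k \<cdot>\<^sub>H k = (-1, 0)"
  unfolding assms quat_mult_def
  by (simp_all add: cross3_def vec_eq_iff forall_3 axis_def inner_vec_def sum_3)

lemma quat_mult_inverse:
  assumes "q \<noteq> 0"
  shows "q \<cdot>\<^sub>H quat_inverse q = (1, 0)" "quat_inverse q \<cdot>\<^sub>H q = (1, 0)"
proof -
  have n: "(norm q)\<^sup>2 = fst q * fst q + snd q \<bullet> snd q"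
    by (simp add: power2_norm_eq_inner inner_prod_def)
  have "(norm q)\<^sup>2 \<noteq> 0" using assms by simp
  then have "fst q * fst q / (norm q)\<^sup>2 + snd q \<bullet> snd q / (norm q)\<^sup>2 = 1"
    by (metis n add_divide_distrib divide_self)
  then show "q \<cdot>\<^sub>H quat_inverse q = (1, 0)" "quat_inverse q \<cdot>\<^sub>H q = (1, 0)"
    by (simp_all add: quat_mult_def quat_inverse_def cross_mult_left cross_mult_right)
qed

subsection \<open>The map \<open>\<psi>\<close> and the binary dodecahedral group\<close>

abbreviation S3 :: "quat set" where
  "S3 \<equiv> sphere 0 1"

text \<open>The projection \<open>snd\<close> loses nothing: see the lemma that follows.\<close>

definition psi :: "quat \<Rightarrow> real^3 \<Rightarrow> real^3" where
  "psi q p = snd (q \<cdot>\<^sub>H (0, p) \<cdot>\<^sub>H quat_inverse q)"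

lemma psi_imaginary: "q \<cdot>\<^sub>H (0, p) \<cdot>\<^sub>H quat_inverse q = (0, psi q p)"
  by (rule prod_eqI)
    (simp_all add: psi_def quat_mult_def quat_inverse_def inner_vec_def cross3_def sum_3 algebra_simps add_divide_distrib diff_divide_distrib)

definition SO3 :: "(real^3 \<Rightarrow> real^3) set" where
  "SO3 = {f. orthogonal_transformation f \<and> det (matrix f) = 1}"

definition dod_x :: real where
  "dod_x = (cot (pi / 5) + cot (2 * pi / 5)) / 2"

definition dod_y :: real where
  "dod_y = (cot (pi / 5) - cot (2 * pi / 5)) / 2"

definition face_directions :: "(real^3) set" where
  "face_directions =
     (\<Union>s\<in>{1, -1}. \<Union>t\<in>{1, -1}.
        {vector [s * dod_x, t * dod_y, 0],
         vector [0, s * dod_x, t * dod_y],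
         vector [s * dod_y, 0, t * dod_x]})"

text \<open>
  The bound \<open>(x + y) / \<surd>3\<close> is the inner product of \<open>(i + j + k) / \<surd>3\<close> with each of the
  unit vectors \<open>x i + y j\<close>, \<open>x j + y k\<close>, \<open>y i + x k\<close>; so the face planes in these three
  directions meet in the vertex \<open>(i + j + k) / \<surd>3\<close> of the unit sphere.
\<close>

definition dodecahedron :: "(real^3) set" where
  "dodecahedron = {p. \<forall>n\<in>face_directions. n \<bullet> p \<le> (dod_x + dod_y) / sqrt 3}"

definition dodecahedral_group :: "(real^3 \<Rightarrow> real^3) set" where
  "dodecahedral_group = {f \<in> SO3. f ` dodecahedron = dodecahedron}"

definition binary_dodecahedral_group :: "quat set" where
  "binary_dodecahedral_group = {q \<in> S3. psi q \<in> dodecahedral_group}"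

subsection \<open>The Voronoi tiling and the 120-cell\<close>

definition dist_S :: "quat \<Rightarrow> quat \<Rightarrow> real" where
  "dist_S p q = arccos (p \<bullet> q)"

definition Vor :: "quat \<Rightarrow> quat set" where
  "Vor q = {r \<in> S3. \<forall>p\<in>binary_dodecahedral_group. dist_S q r \<le> dist_S p r}"

text \<open>
  Faces of a spherical polyhedron are, as for polytopes, its intersections with supporting
  great spheres (hyperplanes through the origin); vertices are the faces consisting of one point.
\<close>

definition spherical_vertex_of :: "quat \<Rightarrow> quat set \<Rightarrow> bool" where
  "spherical_vertex_of v V \<longleftrightarrow>
     (\<exists>a. a \<noteq> 0 \<and> V \<subseteq> {r. a \<bullet> r \<le> 0} \<and> V \<inter> {r. a \<bullet> r = 0} = {v})"

definition T120_vertices :: "quat set" where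
  "T120_vertices = {v. \<exists>q\<in>binary_dodecahedral_group. spherical_vertex_of v (Vor q)}"

definition cell120 :: "quat set" where
  "cell120 = convex hull T120_vertices"

subsection \<open>Regular polytopes\<close>

text \<open>
  \<open>Q exposed_face_of P\<close> also admits \<open>Q = P\<close> and \<open>Q = {}\<close>; the latter has affine dimension
  \<open>-1\<close> and so is in no flag.
\<close>

definition flag_of :: "'a::euclidean_space set list \<Rightarrow> 'a set \<Rightarrow> bool" where
  "flag_of F P \<longleftrightarrow>
     F \<noteq> [] \<and> last F = P \<and>
     (\<forall>l<length F. F ! l exposed_face_of P \<and> aff_dim (F ! l) = int l) \<and>
     sorted_wrt (\<subset>) F"

definition Sym :: "'a::euclidean_space set \<Rightarrow> ('a \<Rightarrow> 'a) set" where
  "Sym P = {\<phi> \<in> extensional (affine hull P).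
     bij_betw \<phi> (affine hull P) (affine hull P) \<and>
     (\<forall>u\<in>affine hull P. \<forall>v\<in>affine hull P. dist (\<phi> u) (\<phi> v) = dist u v) \<and>
     \<phi> ` P = P}"

definition regular_polytope :: "'a::euclidean_space set \<Rightarrow> bool" where
  "regular_polytope P \<longleftrightarrow>
     polytope P \<and>
     (\<forall>F G. flag_of F P \<longrightarrow> flag_of G P \<longrightarrow> (\<exists>\<phi>\<in>Sym P. map ((`) \<phi>) F = G))"

subsection \<open>Position of the dodecahedron\<close>

lemma cot_fifths:
  "0 < cot (2 * pi / 5)" "cot (2 * pi / 5) < cot (pi / 5)"
  "(cot (pi / 5))\<^sup>2 + (cot (2 * pi / 5))\<^sup>2 = 2"
proof -
  define c where "c = cos (pi / 5)"
  define s where "s = sin (pi / 5)"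
  have sp: "s > 0" unfolding s_def by (intro sin_gt_zero) auto
  have cp: "c > 0" unfolding c_def by (rule cos_gt_zero) (use pi_gt_zero in linarith)+
  have dp: "cos (2 * pi / 5) > 0" by (rule cos_gt_zero) (use pi_gt_zero in linarith)+
  have s2: "s\<^sup>2 = 1 - c\<^sup>2" by (simp add: s_def c_def sin_squared_eq)
  have d: "cos (2 * pi / 5) = 2 * c\<^sup>2 - 1"
    using cos_double_cos[of "pi / 5"] by (simp add: c_def)
  have sd: "sin (2 * pi / 5) = 2 * s * c"
    using sin_double[of "pi / 5"] by (simp add: c_def s_def)
  have "sin (2 * pi / 5) = sin (pi - 2 * pi / 5)" by (simp only: sin_pi_minus)
  also have "pi - 2 * pi / 5 = 2 * pi / 5 + pi / 5" by simp
  also have "sin \<dots> = 2 * s * c * c + (2 * c\<^sup>2 - 1) * s"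
    unfolding sin_add d sd c_def s_def by simp
  finally have "s * (2 * c) = s * (4 * c\<^sup>2 - 1)"
    unfolding sd by (simp add: power2_eq_square algebra_simps)
  with sp have q: "c\<^sup>2 = (2 * c + 1) / 4" by simp
  have c1: "cot (pi / 5) = c / s" by (simp add: cot_def c_def s_def)
  have c2: "cot (2 * pi / 5) = (2 * c\<^sup>2 - 1) / (2 * s * c)" by (simp add: cot_def d sd)
  show "0 < cot (2 * pi / 5)" using dp sp cp by (simp add: c2 d)
  have "(2 * c\<^sup>2 - 1) / (2 * s * c) < 2 * c\<^sup>2 / (2 * s * c)"
    using sp cp by (intro divide_strict_right_mono) auto
  also have "\<dots> = c / s" using cp by (simp add: power2_eq_square)
  finally show "cot (2 * pi / 5) < cot (pi / 5)" by (simp add: c1 c2)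
  have s2': "s\<^sup>2 = (3 - 2 * c) / 4" unfolding s2 q by (simp add: field_simps)
  have e: "(2 * c\<^sup>2 - 1)\<^sup>2 = (1 - c) / 2"
    unfolding q using q by (simp add: power2_eq_square field_simps)
  have "0 < 3 - 2 * c" using s2' sp by (smt (verit) divide_nonpos_pos zero_less_power)
  have "(cot (pi / 5))\<^sup>2 + (cot (2 * pi / 5))\<^sup>2
      = (2 * c + 1) / (3 - 2 * c) + (1 - c) / (1 + c)"
  proof -
    have "(2 * s * c)\<^sup>2 = (3 - 2 * c) * (2 * c + 1) / 4"
      unfolding power_mult_distrib s2' q by simp
    also have "\<dots> = (1 + c) / 2" using q by (simp add: power2_eq_square field_simps)
    finally have "(2 * s * c)\<^sup>2 = (1 + c) / 2" .
    then have "(cot (2 * pi / 5))\<^sup>2 = (1 - c) / (1 + c)"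
      unfolding c2 power_divide e by simp
    moreover have "(cot (pi / 5))\<^sup>2 = (2 * c + 1) / (3 - 2 * c)"
      unfolding c1 power_divide s2' q using \<open>0 < 3 - 2 * c\<close> by (simp add: divide_simps) (simp add: algebra_simps)
    ultimately show ?thesis by simp
  qed
  also have "\<dots> = 2"
    using cp \<open>0 < 3 - 2 * c\<close> q by (simp add: divide_simps power2_eq_square) (simp add: algebra_simps)
  finally show "(cot (pi / 5))\<^sup>2 + (cot (2 * pi / 5))\<^sup>2 = 2" .
qed

lemma dod_x_y_squares: "dod_x\<^sup>2 + dod_y\<^sup>2 = 1"
  using cot_fifths(3) unfolding dod_x_def dod_y_def by (simp add: power2_eq_square field_simps)

lemma dod_x_y_pos: "0 < dod_x" "0 < dod_y"
  using cot_fifths unfolding dod_x_def dod_y_def by simp_all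

lemma norm_face_directions: "n \<in> face_directions \<Longrightarrow> norm n = 1"
  using dod_x_y_squares
  by (auto simp: face_directions_def norm_eq_sqrt_inner inner_vec_def sum_3 power2_eq_square
      add.commute)

lemma dodecahedron_vertex:
  defines "v \<equiv> (1 / sqrt 3) *\<^sub>R vector [1, 1, 1] :: real^3"
  shows "norm v = 1" "v extreme_point_of dodecahedron"
proof -
  show "norm v = 1"
    by (simp add: v_def norm_eq_sqrt_inner inner_vec_def sum_3)
  let ?h = "(dod_x + dod_y) / sqrt 3"
  let ?N = "{vector [dod_x, dod_y, 0], vector [0, dod_x, dod_y], vector [dod_y, 0, dod_x]}
    :: (real^3) set"
  have N: "?N \<subseteq> face_directions" by (auto simp: face_directions_def)
  have "v \<in> dodecahedron"
    using dod_x_y_pos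
    by (auto simp: v_def dodecahedron_def face_directions_def inner_vec_def sum_3 divide_simps)
  moreover have eq: "a = v" if "\<forall>n\<in>?N. n \<bullet> a = ?h" for a
  proof -
    define u1 u2 u3 where u: "u1 = a$1 - 1 / sqrt 3" "u2 = a$2 - 1 / sqrt 3" "u3 = a$3 - 1 / sqrt 3"
    have e: "dod_x * u1 = - dod_y * u2" "dod_x * u2 = - dod_y * u3" "dod_x * u3 = - dod_y * u1"
      using that by (simp_all add: u inner_vec_def sum_3 algebra_simps add_divide_distrib)
    have "(dod_x^3 + dod_y^3) * w = 0" if "w = u1 \<or> w = u2 \<or> w = u3" for w
      using e that by algebra
    moreover have "dod_x^3 + dod_y^3 > 0" using dod_x_y_pos by (intro add_pos_pos) auto
    ultimately have "u1 = 0" "u2 = 0" "u3 = 0" by (metis mult_eq_0_iff less_irrefl)+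
    then show ?thesis by (simp add: v_def vec_eq_iff forall_3 u)
  qed
  moreover have False
    if a: "a \<in> dodecahedron" and b: "b \<in> dodecahedron" and m: "v \<in> open_segment a b" for a b
  proof -
    obtain t where t: "0 < t" "t < 1" "v = (1 - t) *\<^sub>R a + t *\<^sub>R b" and "a \<noteq> b"
      using m by (auto simp: in_segment)
    have tight: "n \<bullet> a = ?h \<and> n \<bullet> b = ?h" if n: "n \<in> ?N" for n
    proof -
      have ab: "n \<bullet> a \<le> ?h" "n \<bullet> b \<le> ?h"
        using a b N n unfolding dodecahedron_def by blast+
      have "?h = n \<bullet> v"
        using n by (auto simp: v_def inner_vec_def sum_3 add_divide_distrib)
      also have "\<dots> = (1 - t) * (n \<bullet> a) + t * (n \<bullet> b)"
        by (simp add: t(3) inner_add_right)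
      finally have "(1 - t) * (?h - n \<bullet> a) + t * (?h - n \<bullet> b) = 0"
        by (simp only: right_diff_distrib left_diff_distrib) simp
      moreover have "(1 - t) * (?h - n \<bullet> a) \<ge> 0" "t * (?h - n \<bullet> b) \<ge> 0"
        using ab t by simp_all
      ultimately have "(1 - t) * (?h - n \<bullet> a) = 0" "t * (?h - n \<bullet> b) = 0" by linarith+
      then show ?thesis using t by simp
    qed
    then have "a = v" "b = v" using eq by blast+
    with \<open>a \<noteq> b\<close> show False by simp
  qed
  ultimately show "v extreme_point_of dodecahedron"
    unfolding extreme_point_of_def by blast
qed

end

theory Submission
  imports Defs
begin

text \<open>
  Write \<open>G\<close> for the binary dodecahedral group. The 120-cell is a multiple of the polytope
  \<open>{z. p \<bullet> z \<le> 1 for all p \<in> G}\<close>, and its regularity comes from the linear isometries of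
  \<open>\<real>\<^sup>4\<close> that preserve \<open>G\<close>. Among them are the reflections in the hyperplanes orthogonal
  to the elements of \<open>G\<close>: for unit quaternions the reflection of \<open>x\<close> along \<open>g\<close> is minus the
  product of \<open>g\<close>, the conjugate of \<open>x\<close> and \<open>g\<close> (\<open>mirror_quat\<close>), and \<open>G\<close> is a group that is
  closed under negation.

  Two facts about \<open>G\<close> suffice, so its 120 elements are never listed. Distinct elements have inner
  product below \<open>0.856\<close> (\<open>BD_separated\<close>), because a rotation that moves every face normal of the
  dodecahedron by less than the angle between adjacent normals fixes them all; in particular \<open>G\<close>
  is finite. And \<open>G\<close> contains four simple roots of type \<open>H4\<close>.

  These roots bound a chamber, a simplicial cone. Every vector can be moved into the chamber by the
  isometries (\<open>to_chamber\<close>), and on the chamber the maximum of \<open>p \<bullet> z\<close> over \<open>p \<in> G\<close> is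
  attained at \<open>p = 1\<close> (\<open>chamber_inner_le\<close>). Hence the polytope meets the chamber in an explicit
  simplex, and all its extreme points lie in the orbit of one vertex \<open>v0\<close> of that simplex
  (\<open>extreme_point_orbit\<close>). Radial projection identifies this orbit with the set of vertices of the
  Voronoi tiling (\<open>T120_vertices_eq\<close>), so the 120-cell is the polytope scaled to have its
  vertices on the unit sphere (\<open>cell120_eq\<close>).

  Exactly four facets pass through \<open>v0\<close> (\<open>tight_v0\<close>), and a face is determined by the facets
  that contain it (\<open>face_of_polyhedron_tight\<close>). A flag with vertex \<open>v0\<close> therefore amounts to an
  ordering of four elements of \<open>G\<close>. Reflections that fix \<open>v0\<close> induce all transpositions of these
  four elements (\<open>tight_swap\<close>), so any ordering can be carried to any other (\<open>match_chains\<close>).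
\<close>

section \<open>The golden ratio and the face normals of the dodecahedron\<close>

definition golden :: real where
  "golden = (1 + sqrt 5) / 2"

lemma golden_square: "golden\<^sup>2 = golden + 1"
  by (simp add: golden_def power2_eq_square field_simps)

lemma golden_mult: "golden * golden = golden + 1" "golden * (golden * c) = (golden + 1) * c"
  using golden_square by (simp_all add: power2_eq_square mult.assoc [symmetric])

lemma golden_bounds: "809 / 500 < golden" "golden < 16181 / 10000"
proof -
  have "2.236 < sqrt 5" by (rule real_less_rsqrt) (simp add: power2_eq_square)
  moreover have "sqrt 5 < 2.2362" by (rule real_less_lsqrt) (simp_all add: power2_eq_square)
  ultimately show "809 / 500 < golden" "golden < 16181 / 10000" by (simp_all add: golden_def)
qed

lemma golden_pos: "0 < golden"
  using golden_bounds by linarith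

text \<open>
  With \<open>c = cos (\<pi>/5)\<close> the relation \<open>c\<^sup>2 = (2 c + 1) / 4\<close> says that \<open>2 c\<close> is the golden ratio, and
  \<open>x / y\<close> is a rational function of \<open>c\<close>.
\<close>

lemma dod_x_eq: "dod_x = golden * dod_y"
proof -
  define c where "c = cos (pi / 5)"
  define s where "s = sin (pi / 5)"
  have sp: "s > 0" unfolding s_def by (intro sin_gt_zero) auto
  have cp: "c > 0" unfolding c_def by (rule cos_gt_zero) (use pi_gt_zero in linarith)+
  have s2: "s\<^sup>2 = 1 - c\<^sup>2" by (simp add: s_def c_def sin_squared_eq)
  have d: "cos (2 * pi / 5) = 2 * c\<^sup>2 - 1"
    using cos_double_cos[of "pi / 5"] by (simp add: c_def)
  have sd: "sin (2 * pi / 5) = 2 * s * c"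
    using sin_double[of "pi / 5"] by (simp add: c_def s_def)
  have "sin (2 * pi / 5) = sin (pi - 2 * pi / 5)" by (simp only: sin_pi_minus)
  also have "pi - 2 * pi / 5 = 2 * pi / 5 + pi / 5" by simp
  also have "sin \<dots> = 2 * s * c * c + (2 * c\<^sup>2 - 1) * s"
    unfolding sin_add d sd c_def s_def by simp
  finally have "s * (2 * c) = s * (4 * c\<^sup>2 - 1)"
    unfolding sd by (simp add: power2_eq_square algebra_simps)
  with sp have "2 * c = 4 * c\<^sup>2 - 1" by simp
  then have q: "(2 * c)\<^sup>2 = 2 * c + 1" by algebra
  have "(2 * c - golden) * (2 * c + golden - 1) = 0"
    using q golden_square by (simp add: power2_eq_square algebra_simps)
  moreover have "2 * c + golden - 1 > 0" using cp golden_bounds by linarith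
  ultimately have g: "golden = 2 * c" by (metis eq_iff_diff_eq_0 less_irrefl mult_eq_0_iff)
  have c1: "cot (pi / 5) = c / s" by (simp add: cot_def c_def s_def)
  have c2: "cot (2 * pi / 5) = (2 * c\<^sup>2 - 1) / (2 * s * c)" by (simp add: cot_def d sd)
  have "2 * s * c * (cot (pi / 5) + cot (2 * pi / 5)) = 4 * c\<^sup>2 - 1"
    "2 * s * c * (cot (pi / 5) - cot (2 * pi / 5)) = 1"
    unfolding c1 c2 using sp cp by (simp_all add: field_simps power2_eq_square)
  then have "2 * s * c * (dod_x - golden * dod_y) = 0"
    using q g unfolding dod_x_def dod_y_def by (simp add: power2_eq_square algebra_simps)
  then show ?thesis using sp cp by simp
qed

lemma dod_y_square: "(golden + 2) * (dod_y * dod_y) = 1"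
  using dod_x_y_squares golden_square unfolding dod_x_eq by algebra

lemma dod_y_square_bounds: "27 / 100 < dod_y * dod_y" "dod_y * dod_y < 277 / 1000"
proof -
  have e: "dod_y * dod_y = 1 / (golden + 2)"
    using dod_y_square golden_pos by (simp add: eq_divide_eq mult.commute)
  show "27 / 100 < dod_y * dod_y" "dod_y * dod_y < 277 / 1000"
    unfolding e using golden_bounds by (simp_all add: less_divide_eq divide_less_eq)
qed

lemma vec3_eqI: "v $ 1 = w $ 1 \<Longrightarrow> v $ 2 = w $ 2 \<Longrightarrow> v $ 3 = w $ 3 \<Longrightarrow> v = w" for v w :: "real^3"
  by (simp add: vec_eq_iff forall_3)

lemma inner_vec3: "v \<bullet> w = v $ 1 * w $ 1 + v $ 2 * w $ 2 + v $ 3 * w $ 3" for v w :: "real^3"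
  by (simp add: inner_vec_def sum_3)

lemma face_directions_iff:
  "n \<in> face_directions \<longleftrightarrow>
     \<bar>n $ 1\<bar> = dod_x \<and> \<bar>n $ 2\<bar> = dod_y \<and> n $ 3 = 0 \<or>
     n $ 1 = 0 \<and> \<bar>n $ 2\<bar> = dod_x \<and> \<bar>n $ 3\<bar> = dod_y \<or>
     \<bar>n $ 1\<bar> = dod_y \<and> n $ 2 = 0 \<and> \<bar>n $ 3\<bar> = dod_x"
proof -
  have a: "\<bar>t\<bar> = c \<longleftrightarrow> (\<exists>s\<in>{1, -1}. t = s * c)" if "0 < c" for t c :: real
    using that by auto
  show ?thesis
    unfolding face_directions_def a[OF dod_x_y_pos(1)] a[OF dod_x_y_pos(2)]
      UN_iff insert_iff empty_iff vec_eq_iff forall_3 vector_3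
    by blast
qed

lemma finite_face_directions: "finite face_directions"
  unfolding face_directions_def by auto

lemma face_directions_nonempty: "vector [dod_x, dod_y, 0] \<in> face_directions"
  using dod_x_y_pos by (simp add: face_directions_iff)

lemma face_directions_uminus: "n \<in> face_directions \<Longrightarrow> - n \<in> face_directions"
  by (simp add: face_directions_iff)

text \<open>The exact bound is \<open>1 / \<surd>5\<close>, attained by the normals of adjacent faces.\<close>

lemma inner_face_directions:
  assumes "n \<in> face_directions" "m \<in> face_directions" "n \<noteq> m"
  shows "n \<bullet> m < 23 / 50"
proof -
  let ?z = "dod_y * dod_y"
  have ab: "\<bar>a * b\<bar> = golden * ?z" if "\<bar>a\<bar> = dod_x" "\<bar>b\<bar> = dod_y" for a b
    using that by (simp add: abs_mult dod_x_eq)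
  have ba: "\<bar>b * a\<bar> = golden * ?z" if "\<bar>a\<bar> = dod_x" "\<bar>b\<bar> = dod_y" for a b
    using that by (simp add: abs_mult dod_x_eq)
  have aa: "\<bar>a * b\<bar> = (golden + 1) * ?z" "a \<noteq> b \<Longrightarrow> a * b = - ((golden + 1) * ?z)"
    if "\<bar>a\<bar> = dod_x" "\<bar>b\<bar> = dod_x" for a b
  proof -
    have "dod_x * dod_x = (golden + 1) * ?z"
      using golden_square unfolding dod_x_eq by algebra
    moreover have "a * b = - (dod_x * dod_x)" if "a \<noteq> b"
    proof -
      have "b = - a" using that \<open>\<bar>a\<bar> = dod_x\<close> \<open>\<bar>b\<bar> = dod_x\<close> by linarith
      then show ?thesis using \<open>\<bar>a\<bar> = dod_x\<close> abs_mult_self_eq[of a] by simp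
    qed
    ultimately show "\<bar>a * b\<bar> = (golden + 1) * ?z" "a \<noteq> b \<Longrightarrow> a * b = - ((golden + 1) * ?z)"
      using that by (simp_all add: abs_mult)
  qed
  have bb: "\<bar>a * b\<bar> = ?z" "a \<noteq> b \<Longrightarrow> a * b = - ?z"
    if "\<bar>a\<bar> = dod_y" "\<bar>b\<bar> = dod_y" for a b
  proof -
    show "\<bar>a * b\<bar> = ?z" using that by (simp add: abs_mult)
    show "a * b = - ?z" if "a \<noteq> b"
    proof -
      have "b = - a" using that \<open>\<bar>a\<bar> = dod_y\<close> \<open>\<bar>b\<bar> = dod_y\<close> by linarith
      then show ?thesis using \<open>\<bar>a\<bar> = dod_y\<close> abs_mult_self_eq[of a] by simp
    qed
  qed
  have u: "golden * ?z + 2 * ?z = 1" using dod_y_square by (simp add: algebra_simps)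
  have zb: "27 / 100 < ?z" "?z < 277 / 1000" by (rule dod_y_square_bounds)+
  have g: "golden * ?z < 23 / 50" "golden * ?z > 22 / 50" using u zb by linarith+
  have e: "n $ 1 \<noteq> m $ 1 \<or> n $ 2 \<noteq> m $ 2 \<or> n $ 3 \<noteq> m $ 3"
    using assms(3) vec3_eqI by blast
  have g1: "(golden + 1) * ?z = golden * ?z + ?z" by (simp add: algebra_simps)
  have same: "a * c + b * d < 23 / 50"
    if "\<bar>a\<bar> = dod_x" "\<bar>c\<bar> = dod_x" "\<bar>b\<bar> = dod_y" "\<bar>d\<bar> = dod_y" "a \<noteq> c \<or> b \<noteq> d" for a b c d
  proof (cases "a = c")
    case True
    then have "b * d = - ?z" using bb(2)[of b d] that by simp
    then show ?thesis using aa(1)[of a c] that g g1 by linarith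
  next
    case False
    then show ?thesis using aa(2)[of a c] bb(1)[of b d] that g g1 zb by linarith
  qed
  have less: "t < 23 / 50" if "\<bar>t\<bar> = golden * ?z" for t
    using that g by linarith
  have cases: thesis
    if "v \<in> face_directions"
      "\<bar>v $ 1\<bar> = dod_x \<Longrightarrow> \<bar>v $ 2\<bar> = dod_y \<Longrightarrow> v $ 3 = 0 \<Longrightarrow> thesis"
      "\<bar>v $ 2\<bar> = dod_x \<Longrightarrow> \<bar>v $ 3\<bar> = dod_y \<Longrightarrow> v $ 1 = 0 \<Longrightarrow> thesis"
      "\<bar>v $ 3\<bar> = dod_x \<Longrightarrow> \<bar>v $ 1\<bar> = dod_y \<Longrightarrow> v $ 2 = 0 \<Longrightarrow> thesis"
    for v and thesis
    using that unfolding face_directions_iff by blast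
  show ?thesis
    unfolding inner_vec3
  proof (rule cases[OF assms(1)]; rule cases[OF assms(2)])
    assume n: "\<bar>n $ 1\<bar> = dod_x" "\<bar>n $ 2\<bar> = dod_y" "n $ 3 = 0"
      and m: "\<bar>m $ 1\<bar> = dod_x" "\<bar>m $ 2\<bar> = dod_y" "m $ 3 = 0"
    show "n $ 1 * m $ 1 + n $ 2 * m $ 2 + n $ 3 * m $ 3 < 23 / 50"
      using same[OF n(1) m(1) n(2) m(2)] e n(3) m(3) by (auto simp: add_ac)
  next
    assume n: "\<bar>n $ 1\<bar> = dod_x" "\<bar>n $ 2\<bar> = dod_y" "n $ 3 = 0"
      and m: "\<bar>m $ 2\<bar> = dod_x" "\<bar>m $ 3\<bar> = dod_y" "m $ 1 = 0"
    show "n $ 1 * m $ 1 + n $ 2 * m $ 2 + n $ 3 * m $ 3 < 23 / 50"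
      using less[OF ba[OF m(1) n(2)]] n(3) m(3) by simp
  next
    assume n: "\<bar>n $ 1\<bar> = dod_x" "\<bar>n $ 2\<bar> = dod_y" "n $ 3 = 0"
      and m: "\<bar>m $ 3\<bar> = dod_x" "\<bar>m $ 1\<bar> = dod_y" "m $ 2 = 0"
    show "n $ 1 * m $ 1 + n $ 2 * m $ 2 + n $ 3 * m $ 3 < 23 / 50"
      using less[OF ab[OF n(1) m(2)]] n(3) m(3) by simp
  next
    assume n: "\<bar>n $ 2\<bar> = dod_x" "\<bar>n $ 3\<bar> = dod_y" "n $ 1 = 0"
      and m: "\<bar>m $ 1\<bar> = dod_x" "\<bar>m $ 2\<bar> = dod_y" "m $ 3 = 0"
    show "n $ 1 * m $ 1 + n $ 2 * m $ 2 + n $ 3 * m $ 3 < 23 / 50"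
      using less[OF ab[OF n(1) m(2)]] n(3) m(3) by simp
  next
    assume n: "\<bar>n $ 2\<bar> = dod_x" "\<bar>n $ 3\<bar> = dod_y" "n $ 1 = 0"
      and m: "\<bar>m $ 2\<bar> = dod_x" "\<bar>m $ 3\<bar> = dod_y" "m $ 1 = 0"
    show "n $ 1 * m $ 1 + n $ 2 * m $ 2 + n $ 3 * m $ 3 < 23 / 50"
      using same[OF n(1) m(1) n(2) m(2)] e n(3) m(3) by (auto simp: add_ac)
  next
    assume n: "\<bar>n $ 2\<bar> = dod_x" "\<bar>n $ 3\<bar> = dod_y" "n $ 1 = 0"
      and m: "\<bar>m $ 3\<bar> = dod_x" "\<bar>m $ 1\<bar> = dod_y" "m $ 2 = 0"
    show "n $ 1 * m $ 1 + n $ 2 * m $ 2 + n $ 3 * m $ 3 < 23 / 50"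
      using less[OF ba[OF m(1) n(2)]] n(3) m(3) by simp
  next
    assume n: "\<bar>n $ 3\<bar> = dod_x" "\<bar>n $ 1\<bar> = dod_y" "n $ 2 = 0"
      and m: "\<bar>m $ 1\<bar> = dod_x" "\<bar>m $ 2\<bar> = dod_y" "m $ 3 = 0"
    show "n $ 1 * m $ 1 + n $ 2 * m $ 2 + n $ 3 * m $ 3 < 23 / 50"
      using less[OF ba[OF m(1) n(2)]] n(3) m(3) by simp
  next
    assume n: "\<bar>n $ 3\<bar> = dod_x" "\<bar>n $ 1\<bar> = dod_y" "n $ 2 = 0"
      and m: "\<bar>m $ 2\<bar> = dod_x" "\<bar>m $ 3\<bar> = dod_y" "m $ 1 = 0"
    show "n $ 1 * m $ 1 + n $ 2 * m $ 2 + n $ 3 * m $ 3 < 23 / 50"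
      using less[OF ab[OF n(1) m(2)]] n(3) m(3) by simp
  next
    assume n: "\<bar>n $ 3\<bar> = dod_x" "\<bar>n $ 1\<bar> = dod_y" "n $ 2 = 0"
      and m: "\<bar>m $ 3\<bar> = dod_x" "\<bar>m $ 1\<bar> = dod_y" "m $ 2 = 0"
    show "n $ 1 * m $ 1 + n $ 2 * m $ 2 + n $ 3 * m $ 3 < 23 / 50"
      using same[OF n(1) m(1) n(2) m(2)] e n(3) m(3) by (auto simp: add_ac)
  qed
qed

section \<open>Quaternions acting on the imaginary quaternions\<close>

text \<open>The quaternion \<open>a + b i + c j + d k\<close>.\<close>

definition Quat :: "real \<Rightarrow> real \<Rightarrow> real \<Rightarrow> real \<Rightarrow> quat" where
  "Quat a b c d = (a, vector [b, c, d])"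

lemma Quat_arith:
  "Quat a b c d + Quat a' b' c' d' = Quat (a + a') (b + b') (c + c') (d + d')"
  "Quat a b c d - Quat a' b' c' d' = Quat (a - a') (b - b') (c - c') (d - d')"
  "- Quat a b c d = Quat (- a) (- b) (- c) (- d)"
  "t *\<^sub>R Quat a b c d = Quat (t * a) (t * b) (t * c) (t * d)"
  by (auto simp: Quat_def intro!: vec3_eqI)

lemma Quat_eq_iff: "Quat a b c d = Quat a' b' c' d' \<longleftrightarrow> a = a' \<and> b = b' \<and> c = c' \<and> d = d'"
  by (auto simp: Quat_def vec_eq_iff forall_3)

lemma Quat_inner: "Quat a b c d \<bullet> Quat a' b' c' d' = a * a' + b * b' + c * c' + d * d'"
  by (simp add: Quat_def inner_prod_def inner_vec3)

lemma Quat_mult: "Quat a b c d \<cdot>\<^sub>H Quat a' b' c' d' =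
    Quat (a * a' - b * b' - c * c' - d * d') (a * b' + b * a' + c * d' - d * c')
      (a * c' - b * d' + c * a' + d * b') (a * d' + b * c' - c * b' + d * a')"
  by (auto simp: Quat_def quat_mult_def inner_vec3 cross3_def intro!: vec3_eqI)

lemma Quat_exhaust: obtains a b c d where "q = Quat a b c d"
proof -
  have "q = Quat (fst q) (snd q $ 1) (snd q $ 2) (snd q $ 3)"
    by (simp add: Quat_def prod_eq_iff vec_eq_iff forall_3)
  then show ?thesis by (rule that)
qed

definition quat_conj :: "quat \<Rightarrow> quat" where
  "quat_conj q = (fst q, - snd q)"

lemma quat_conj_Quat: "quat_conj (Quat a b c d) = Quat a (- b) (- c) (- d)"
  by (auto simp: Quat_def quat_conj_def intro!: vec3_eqI)

lemma quat_mult_assoc: "p \<cdot>\<^sub>H q \<cdot>\<^sub>H r = p \<cdot>\<^sub>H (q \<cdot>\<^sub>H r)"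
  by (rule Quat_exhaust[of p], rule Quat_exhaust[of q], rule Quat_exhaust[of r])
    (simp add: Quat_mult Quat_eq_iff algebra_simps)

lemma quat_conj_mult: "quat_conj (p \<cdot>\<^sub>H q) = quat_conj q \<cdot>\<^sub>H quat_conj p"
  by (rule Quat_exhaust[of p], rule Quat_exhaust[of q])
    (simp add: Quat_mult quat_conj_Quat Quat_eq_iff algebra_simps)

lemma norm_quat_conj: "norm (quat_conj q) = norm q"
  by (simp add: quat_conj_def norm_prod_def)

lemma norm_1_iff: "norm q = 1 \<longleftrightarrow> q \<bullet> q = 1" for q :: quat
  by (simp add: norm_eq_sqrt_inner)

lemma norm_quat_mult: "norm (p \<cdot>\<^sub>H q) = norm p * norm q"
proof -
  have "(p \<cdot>\<^sub>H q) \<bullet> (p \<cdot>\<^sub>H q) = (p \<bullet> p) * (q \<bullet> q)"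
    by (rule Quat_exhaust[of p], rule Quat_exhaust[of q])
      (simp add: Quat_mult Quat_inner algebra_simps)
  then show ?thesis by (simp add: norm_eq_sqrt_inner real_sqrt_mult)
qed

lemma quat_mult_one: "(1, 0) \<cdot>\<^sub>H q = q" "q \<cdot>\<^sub>H (1, 0) = q"
  by (simp_all add: quat_mult_def)

lemma quat_inner_eq: "p \<bullet> q = fst (quat_conj p \<cdot>\<^sub>H q)"
  by (simp add: quat_conj_def quat_mult_def inner_prod_def)

lemma quat_inverse_unit: "norm q = 1 \<Longrightarrow> quat_inverse q = quat_conj q"
  by (simp add: quat_inverse_def quat_conj_def)

lemma quat_conj_cancel:
  assumes "norm q = 1"
  shows "q \<cdot>\<^sub>H quat_conj q = (1, 0)" "quat_conj q \<cdot>\<^sub>H q = (1, 0)"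
proof -
  have "q \<noteq> 0" using assms by auto
  then show "q \<cdot>\<^sub>H quat_conj q = (1, 0)" "quat_conj q \<cdot>\<^sub>H q = (1, 0)"
    using quat_mult_inverse[of q] unfolding quat_inverse_unit[OF assms] by blast+
qed

lemma psi_eq:
  assumes "norm q = 1"
  shows "psi q p = ((fst q)\<^sup>2 - snd q \<bullet> snd q) *\<^sub>R p + (2 * (snd q \<bullet> p)) *\<^sub>R snd q
    + (2 * fst q) *\<^sub>R cross3 (snd q) p"
  by (rule vec3_eqI)
    (simp_all add: psi_def quat_inverse_unit[OF assms] quat_conj_def quat_mult_def cross3_def
      inner_vec3 power2_eq_square algebra_simps)

lemma psi_mult:
  assumes "norm p = 1" "norm q = 1"
  shows "psi (p \<cdot>\<^sub>H q) v = psi p (psi q v)"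
proof -
  have n: "norm (p \<cdot>\<^sub>H q) = 1" using assms by (simp add: norm_quat_mult)
  have "(0, psi (p \<cdot>\<^sub>H q) v) = p \<cdot>\<^sub>H q \<cdot>\<^sub>H (0, v) \<cdot>\<^sub>H quat_conj (p \<cdot>\<^sub>H q)"
    by (simp only: psi_imaginary[of "p \<cdot>\<^sub>H q", symmetric] quat_inverse_unit[OF n])
  also have "\<dots> = p \<cdot>\<^sub>H (q \<cdot>\<^sub>H (0, v) \<cdot>\<^sub>H quat_inverse q) \<cdot>\<^sub>H quat_inverse p"
    by (simp only: quat_inverse_unit[OF assms(1)] quat_inverse_unit[OF assms(2)]
        quat_conj_mult quat_mult_assoc)
  also have "\<dots> = (0, psi p (psi q v))"
    by (simp only: psi_imaginary)
  finally show ?thesis by (simp only: prod.inject)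
qed

lemma psi_conj_cancel:
  assumes "norm q = 1"
  shows "psi q (psi (quat_conj q) v) = v" "psi (quat_conj q) (psi q v) = v"
proof -
  have one: "psi (1, 0) v = v" by (simp add: psi_eq)
  have c: "norm (quat_conj q) = 1" using assms by (simp add: norm_quat_conj)
  show "psi q (psi (quat_conj q) v) = v"
    using psi_mult[OF assms c, of v] one unfolding quat_conj_cancel(1)[OF assms] by metis
  show "psi (quat_conj q) (psi q v) = v"
    using psi_mult[OF c assms, of v] one unfolding quat_conj_cancel(2)[OF assms] by metis
qed

lemma psi_uminus: "psi (- q) = psi q"
proof
  fix v
  have m: "(- p) \<cdot>\<^sub>H r = - (p \<cdot>\<^sub>H r)" "p \<cdot>\<^sub>H (- r) = - (p \<cdot>\<^sub>H r)" for p r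
    by (simp_all add: quat_mult_def)
  have "quat_inverse (- q) = - quat_inverse q" by (simp add: quat_inverse_def)
  then show "psi (- q) v = psi q v" by (simp add: psi_def m)
qed

lemma inner_psi_self:
  assumes "norm q = 1" "norm n = 1"
  shows "n \<bullet> psi q n = 2 * (fst q)\<^sup>2 - 1 + 2 * (snd q \<bullet> n)\<^sup>2"
proof -
  have "snd q \<bullet> snd q = 1 - (fst q)\<^sup>2"
    using assms(1) by (simp add: norm_1_iff inner_prod_def power2_eq_square)
  then show ?thesis
    using assms(2) by (simp add: psi_eq[OF assms(1)] inner_add_right dot_cross_self norm_eq_1
        inner_commute power2_eq_square algebra_simps)
qed

lemma orthogonal_transformation_psi:
  assumes "norm q = 1"
  shows "orthogonal_transformation (psi q)"
proof -
  have l: "linear (psi q)"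
    unfolding psi_eq[OF assms]
    by (rule linearI) (simp_all add: algebra_simps inner_add_right cross_add_right cross_mult_right)
  have "norm (psi q v) = norm v" for v
  proof -
    have "norm (q \<cdot>\<^sub>H (0, v) \<cdot>\<^sub>H quat_inverse q) = norm v"
      using assms by (simp add: norm_quat_mult quat_inverse_unit norm_quat_conj)
    then show ?thesis unfolding psi_imaginary by simp
  qed
  with l show ?thesis by (simp add: orthogonal_transformation)
qed



lemma psi_SO3:
  assumes "norm q = 1"
  shows "psi q \<in> SO3"
proof -
  obtain a b c d where q: "q = Quat a b c d" by (rule Quat_exhaust)
  have 1: "a * a + b * b + c * c + d * d = 1"
    using assms unfolding norm_1_iff q Quat_inner .
  have "det (matrix (psi q)) = (a * a + b * b + c * c + d * d)^3"
    unfolding det_3 matrix_def psi_eq[OF assms]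
    by (simp add: q Quat_def inner_vec3 cross3_def axis_def power3_eq_cube power2_eq_square algebra_simps)
  then show ?thesis
    using 1 orthogonal_transformation_psi[OF assms] by (simp add: SO3_def)
qed

section \<open>The binary dodecahedral group\<close>

abbreviation BD :: "quat set" where
  "BD \<equiv> binary_dodecahedral_group"

lemma BD_iff: "q \<in> BD \<longleftrightarrow> norm q = 1 \<and> psi q ` dodecahedron = dodecahedron"
  using psi_SO3[of q] by (auto simp: binary_dodecahedral_group_def dodecahedral_group_def)

lemma BD_norm: "q \<in> BD \<Longrightarrow> norm q = 1"
  by (simp add: BD_iff)

lemma BD_inner_self: "q \<in> BD \<Longrightarrow> q \<bullet> q = 1"
  using BD_norm norm_1_iff by blast

lemma BD_one: "(1, 0) \<in> BD"
proof -
  have "psi (1, 0) = (\<lambda>v. v)" by (rule ext) (simp add: psi_eq)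
  then show ?thesis by (simp add: BD_iff)
qed

lemma BD_uminus: "q \<in> BD \<Longrightarrow> - q \<in> BD"
  by (simp add: BD_iff psi_uminus)

lemma BD_mult:
  assumes "p \<in> BD" "q \<in> BD"
  shows "p \<cdot>\<^sub>H q \<in> BD"
proof -
  have "psi (p \<cdot>\<^sub>H q) = psi p \<circ> psi q"
    using assms BD_norm psi_mult by fastforce
  then have "psi (p \<cdot>\<^sub>H q) ` dodecahedron = psi p ` psi q ` dodecahedron"
    by (simp add: image_comp)
  then show ?thesis using assms by (simp add: BD_iff norm_quat_mult)
qed

lemma BD_conj:
  assumes "q \<in> BD"
  shows "quat_conj q \<in> BD"
proof -
  have "psi (quat_conj q) ` psi q ` dodecahedron = dodecahedron"
    using psi_conj_cancel(2)[OF BD_norm[OF assms]] by (simp add: image_image)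
  then show ?thesis using assms by (simp add: BD_iff norm_quat_conj)
qed

text \<open>An imaginary unit quaternion acts on \<open>\<bbbI>\<close> as the half-turn about its own axis.\<close>

lemma half_turn_BD:
  assumes "norm u = 1" and "\<And>n. n \<in> face_directions \<Longrightarrow> (2 * (u \<bullet> n)) *\<^sub>R u - n \<in> face_directions"
  shows "(0, u) \<in> BD"
proof -
  have n: "norm ((0, u) :: quat) = 1" using assms(1) by simp
  have p: "psi (0, u) v = (2 * (u \<bullet> v)) *\<^sub>R u - v" for v
    using assms(1) by (simp add: psi_eq[OF n] norm_eq_1)
  have sub: "psi (0, u) v \<in> dodecahedron" if "v \<in> dodecahedron" for v
  proof -
    have "m \<bullet> psi (0, u) v = ((2 * (u \<bullet> m)) *\<^sub>R u - m) \<bullet> v" for m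
      by (simp add: p inner_diff_left inner_diff_right inner_commute)
    then show ?thesis using that assms(2) by (auto simp: dodecahedron_def)
  qed
  have "psi (0, u) (psi (0, u) v) = v" for v
    using assms(1) by (simp add: p inner_diff_right norm_eq_1 algebra_simps)
  then have "psi (0, u) ` dodecahedron = dodecahedron"
    using sub by (metis (no_types, lifting) image_iff subsetI subset_antisym)
  then show ?thesis using n by (simp add: BD_iff)
qed

text \<open>
  The face centres are the points of the dodecahedron at the distance of its faces from the
  origin that lie on its boundary. This description involves only the norm and the dodecahedron,
  so a symmetry of the dodecahedron permutes the face normals.
\<close>

lemma face_centre_iff:
  defines "h \<equiv> (dod_x + dod_y) / sqrt 3"
  shows "v \<in> face_directions \<longleftrightarrow>
    norm v = 1 \<and> h *\<^sub>R v \<in> dodecahedron \<and> (\<forall>e>0. ((1 + e) * h) *\<^sub>R v \<notin> dodecahedron)"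
proof
  have h: "h > 0" using dod_x_y_pos by (simp add: h_def)
  have mem: "p \<in> dodecahedron \<longleftrightarrow> (\<forall>n\<in>face_directions. n \<bullet> p \<le> h)" for p
    by (simp add: dodecahedron_def h_def)
  show "norm v = 1 \<and> h *\<^sub>R v \<in> dodecahedron \<and> (\<forall>e>0. ((1 + e) * h) *\<^sub>R v \<notin> dodecahedron)"
    if v: "v \<in> face_directions"
  proof (intro conjI allI impI)
    show nv: "norm v = 1" using v by (rule norm_face_directions)
    show "h *\<^sub>R v \<in> dodecahedron"
      unfolding mem
    proof
      fix n :: "real^3" assume "n \<in> face_directions"
      then have "n \<bullet> v \<le> 1" using norm_cauchy_schwarz[of n v] nv norm_face_directions by simp
      then show "n \<bullet> h *\<^sub>R v \<le> h" using h by simp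
    qed
    fix e :: real assume e: "e > 0"
    have "h < v \<bullet> ((1 + e) * h) *\<^sub>R v" using nv h e by (simp add: norm_eq_1)
    then show "((1 + e) * h) *\<^sub>R v \<notin> dodecahedron" using v mem by fastforce
  qed
  show "v \<in> face_directions"
    if v: "norm v = 1 \<and> h *\<^sub>R v \<in> dodecahedron \<and> (\<forall>e>0. ((1 + e) * h) *\<^sub>R v \<notin> dodecahedron)"
  proof (rule ccontr)
    assume no: "v \<notin> face_directions"
    define M where "M = Max ((\<lambda>n. n \<bullet> v) ` face_directions)"
    have fin: "finite ((\<lambda>n. n \<bullet> v) ` face_directions)" "(\<lambda>n. n \<bullet> v) ` face_directions \<noteq> {}"
      using finite_face_directions face_directions_nonempty by auto
    obtain n where n: "n \<in> face_directions" "M = n \<bullet> v"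
      using Max_in[OF fin] unfolding M_def by blast
    have le: "m \<bullet> v \<le> M" if "m \<in> face_directions" for m
      unfolding M_def using fin that by simp
    have "M < 1"
    proof -
      have "n \<bullet> v \<le> 1" "n \<bullet> v \<noteq> 1"
        using norm_cauchy_schwarz[of n v] norm_cauchy_schwarz_eq[of n v] n no v norm_face_directions[OF n(1)]
        by auto
      then show ?thesis using n by simp
    qed
    moreover have "0 \<le> M" using le[OF n(1)] le[OF face_directions_uminus[OF n(1)]] n(2) by simp
    \<comment> \<open>\<open>e = 1 - M\<close> works because \<open>1 - (2 - M) M\<close> is a square.\<close>
    ultimately obtain e where e: "e > 0" "(1 + e) * M \<le> 1"
    proof -
      have "(1 + (1 - M)) * M \<le> 1"
        using sum_squares_ge_zero[of "1 - M" 0] by (simp add: algebra_simps)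
      then show thesis using that[of "1 - M"] \<open>M < 1\<close> by simp
    qed
    have "((1 + e) * h) *\<^sub>R v \<in> dodecahedron"
      unfolding mem
    proof
      fix m :: "real^3" assume "m \<in> face_directions"
      then have "(1 + e) * (m \<bullet> v) \<le> (1 + e) * M" using le e by (simp add: mult_left_mono)
      then have "h * ((1 + e) * (m \<bullet> v)) \<le> h * 1" using e(2) h by (intro mult_left_mono) linarith+
      then show "m \<bullet> ((1 + e) * h) *\<^sub>R v \<le> h" by (simp add: mult_ac)
    qed
    then show False using v e(1) by blast
  qed
qed

lemma psi_face_directions:
  assumes "q \<in> BD" "n \<in> face_directions"
  shows "psi q n \<in> face_directions"
proof -
  have o: "orthogonal_transformation (psi q)"
    using assms(1) by (simp add: BD_norm orthogonal_transformation_psi)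
  have "psi q v \<in> dodecahedron \<longleftrightarrow> v \<in> dodecahedron" for v
    using assms(1) inj_image_mem_iff[OF orthogonal_transformation_inj[OF o], of v dodecahedron]
    by (simp add: BD_iff)
  then show ?thesis
    using assms(2) unfolding face_centre_iff
    by (simp add: orthogonal_transformation_norm[OF o]
        flip: orthogonal_transformation_scaleR[OF o])
qed

text \<open>
  A symmetry that turns each face normal by less than the angle between adjacent normals fixes
  them all.
\<close>

lemma BD_near_one:
  assumes "q \<in> BD" "107 / 125 \<le> fst q"
  shows "q = (1, 0)"
proof -
  have nq: "norm q = 1" using assms(1) by (rule BD_norm)
  have "107 / 125 * (107 / 125) \<le> fst q * fst q" using assms(2) by (intro mult_mono) auto
  then have a: "93 / 200 \<le> 2 * (fst q)\<^sup>2 - 1" by (simp add: power2_eq_square)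
  have s: "snd q \<bullet> snd q = 1 - (fst q)\<^sup>2"
    using nq by (simp add: norm_1_iff inner_prod_def power2_eq_square)
  have eq: "(snd q \<bullet> n)\<^sup>2 = snd q \<bullet> snd q" if n: "n \<in> face_directions" for n
  proof -
    have nn: "norm n = 1" using n by (rule norm_face_directions)
    have "n = psi q n"
    proof (rule ccontr)
      assume "n \<noteq> psi q n"
      then have "n \<bullet> psi q n < 23 / 50"
        using inner_face_directions n psi_face_directions[OF assms(1) n] by blast
      then show False using inner_psi_self[OF nq nn] a zero_le_power2[of "snd q \<bullet> n"] by linarith
    qed
    then have "n \<bullet> psi q n = 1" using nn by (simp add: norm_eq_1)
    then show ?thesis using inner_psi_self[OF nq nn] s by simp
  qed
  define v where "v = snd q"
  have N: "vector [dod_x, dod_y, 0] \<in> face_directions" "vector [dod_x, - dod_y, 0] \<in> face_directions"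
    "vector [0, dod_x, dod_y] \<in> face_directions" "vector [0, dod_x, - dod_y] \<in> face_directions"
    "vector [dod_y, 0, dod_x] \<in> face_directions" "vector [dod_y, 0, - dod_x] \<in> face_directions"
    using dod_x_y_pos by (simp_all add: face_directions_iff)
  note E = N[THEN eq, folded v_def, unfolded inner_vec3 vector_3]
  \<comment> \<open>The six unit vectors form a tight frame: their squared components along \<open>v\<close> add up to \<open>2 |v|\<^sup>2\<close>.\<close>
  have "6 * (v \<bullet> v) = 2 * (v \<bullet> v)"
    using E dod_x_y_squares unfolding inner_vec3 by algebra
  then have "v = 0" by simp
  then have "(fst q)\<^sup>2 = 1" using s by (simp add: v_def)
  then have "fst q = 1" using assms(2) by (simp add: power2_eq_1_iff)
  then show ?thesis using \<open>v = 0\<close> by (simp add: v_def prod_eq_iff)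
qed

lemma BD_separated:
  assumes "p \<in> BD" "q \<in> BD" "107 / 125 \<le> p \<bullet> q"
  shows "p = q"
proof -
  have "quat_conj p \<cdot>\<^sub>H q = (1, 0)"
    using assms by (intro BD_near_one BD_mult BD_conj) (simp_all add: quat_inner_eq)
  then have "p \<cdot>\<^sub>H (quat_conj p \<cdot>\<^sub>H q) = p" by (simp add: quat_mult_one)
  then show ?thesis
    using assms(1) by (simp add: quat_mult_assoc[symmetric] quat_conj_cancel BD_norm quat_mult_one)
qed

lemma finite_BD: "finite BD"
proof -
  have "p = q" if "p \<in> BD" "q \<in> BD" "dist p q < 1 / 2" for p q
  proof (rule BD_separated)
    have "(dist p q)\<^sup>2 = 2 - 2 * (p \<bullet> q)"
      using that by (simp add: dist_norm power2_norm_eq_inner inner_diff_left inner_diff_right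
          BD_inner_self inner_commute)
    moreover have "(dist p q)\<^sup>2 < (1 / 2)\<^sup>2"
      using that(3) by (intro power_strict_mono) auto
    ultimately show "107 / 125 \<le> p \<bullet> q" by (simp add: power2_eq_square)
  qed (use that in auto)
  then have "uniform_discrete BD"
    unfolding uniform_discrete_def by (intro exI[of _ "1 / 2"]) auto
  moreover have "bounded BD"
    using BD_norm by (intro boundedI[of _ 1]) auto
  ultimately show ?thesis using uniform_discrete_finite_iff by blast
qed

section \<open>Reflections\<close>

text \<open>The reflection in the hyperplane orthogonal to the unit vector \<open>g\<close>.\<close>

definition mirror :: "'a::real_inner \<Rightarrow> 'a \<Rightarrow> 'a" where
  "mirror g x = x - (2 * (x \<bullet> g)) *\<^sub>R g"

lemma inner_mirror: "mirror g x \<bullet> y = x \<bullet> y - 2 * (x \<bullet> g) * (g \<bullet> y)"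
  by (simp add: mirror_def inner_diff_left)

lemma mirror_mirror: "g \<bullet> g = 1 \<Longrightarrow> mirror g (mirror g x) = x"
  by (simp add: mirror_def inner_diff_left algebra_simps)

lemma orthogonal_transformation_mirror:
  assumes "g \<bullet> g = 1"
  shows "orthogonal_transformation (mirror g)"
  unfolding orthogonal_transformation_def
proof (intro conjI allI)
  show "linear (mirror g)"
    by (rule linearI) (simp_all add: mirror_def inner_add_left algebra_simps)
  show "mirror g v \<bullet> mirror g w = v \<bullet> w" for v w
    using assms by (simp add: mirror_def inner_diff_left inner_diff_right inner_commute)
qed

lemma mirror_quat:
  assumes "norm g = 1"
  shows "mirror g x = - (g \<cdot>\<^sub>H quat_conj x \<cdot>\<^sub>H g)"
proof -
  obtain a b c d where g: "g = Quat a b c d" by (rule Quat_exhaust)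
  obtain a' b' c' d' where x: "x = Quat a' b' c' d'" by (rule Quat_exhaust)
  have 1: "a * a + b * b + c * c + d * d = 1"
    using assms unfolding norm_1_iff g Quat_inner .
  show ?thesis
    unfolding g x mirror_def Quat_inner quat_conj_Quat Quat_mult Quat_arith Quat_eq_iff
    using 1 by (intro conjI; algebra)
qed

lemma mirror_BD:
  assumes "g \<in> BD" "x \<in> BD"
  shows "mirror g x \<in> BD"
  using assms by (simp add: mirror_quat BD_norm BD_uminus BD_mult BD_conj)

text \<open>The linear isometries that preserve the binary dodecahedral group.\<close>

definition BD_isometries :: "(quat \<Rightarrow> quat) set" where
  "BD_isometries = {f. orthogonal_transformation f \<and> f ` BD = BD}"

lemma mirror_isometry:
  assumes "g \<in> BD"
  shows "mirror g \<in> BD_isometries"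
proof -
  have "mirror g ` BD = BD"
    using mirror_BD[OF assms] mirror_mirror[OF BD_inner_self[OF assms]]
    by (metis (no_types, lifting) image_iff subsetI subset_antisym)
  then show ?thesis
    using assms by (simp add: BD_isometries_def orthogonal_transformation_mirror BD_inner_self)
qed

lemma id_isometry: "(\<lambda>x. x) \<in> BD_isometries"
  by (simp add: BD_isometries_def)

lemma comp_isometry:
  assumes "f \<in> BD_isometries" "g \<in> BD_isometries"
  shows "f \<circ> g \<in> BD_isometries"
  using assms orthogonal_transformation_compose[of f g] image_comp[of f g BD]
  by (simp only: BD_isometries_def mem_Collect_eq)

lemma isometry_inner: "f \<in> BD_isometries \<Longrightarrow> f x \<bullet> f y = x \<bullet> y"
  unfolding BD_isometries_def orthogonal_transformation_def by blast

lemma isometry_linear: "f \<in> BD_isometries \<Longrightarrow> linear f"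
  by (simp add: BD_isometries_def orthogonal_transformation_def)

lemma isometry_norm: "f \<in> BD_isometries \<Longrightarrow> norm (f x) = norm x"
  by (simp add: norm_eq_sqrt_inner isometry_inner)

lemma isometry_BD: "f \<in> BD_isometries \<Longrightarrow> p \<in> BD \<Longrightarrow> f p \<in> BD"
  unfolding BD_isometries_def by blast

lemma isometry_inverse:
  assumes "f \<in> BD_isometries"
  obtains g where "g \<in> BD_isometries" "\<And>x. g (f x) = x" "\<And>x. f (g x) = x"
proof
  have o: "orthogonal_transformation f" and i: "f ` BD = BD"
    using assms by (auto simp: BD_isometries_def)
  have b: "bij f" using o by (rule orthogonal_transformation_bij)
  then show gf: "inv f (f x) = x" and "f (inv f x) = x" for x
    by (simp_all add: bij_is_inj bij_is_surj surj_f_inv_f)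
  have "inv f ` BD = BD"
    using i gf by (metis (no_types, lifting) image_comp image_cong image_ident comp_apply)
  then show "inv f \<in> BD_isometries"
    using o by (simp add: BD_isometries_def orthogonal_transformation_inv)
qed

section \<open>A fundamental chamber of the reflection group\<close>

abbreviation unit_quat :: quat where
  "unit_quat \<equiv> Quat 1 0 0 0"

lemma unit_quat_eq: "unit_quat = (1, 0)"
  by (simp add: Quat_def prod_eq_iff vec_eq_iff forall_3)

text \<open>
  Simple roots \<open>r0, r1, r2, r3\<close> of type \<open>H4\<close>: consecutive ones meet at the angles \<open>4\<pi>/5\<close>,
  \<open>2\<pi>/3\<close>, \<open>2\<pi>/3\<close>, the others are orthogonal.
\<close>

definition r0 :: quat where "r0 = Quat 0 0 0 1"
definition r1 :: quat where "r1 = Quat 0 ((golden - 1) / 2) (- 1 / 2) (- golden / 2)"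
definition r2 :: quat where "r2 = Quat 0 0 1 0"
definition r3 :: quat where "r3 = Quat ((golden - 1) / 2) (- golden / 2) (- 1 / 2) 0"

text \<open>
  The vertices, other than the origin, of the simplex cut off the chamber by the hyperplane
  \<open>{z. fst z = 1}\<close>; the last one is \<open>unit_quat\<close>. They span the edges of the chamber, and they are
  a vertex, an edge midpoint, a face centre and the centre of a dodecahedral cell.
\<close>

definition v0 :: quat where "v0 = Quat 1 (2 - golden) 0 (5 - 3 * golden)"
definition v1 :: quat where "v1 = Quat 1 (2 - golden) 0 0"
definition v2 :: quat where "v2 = Quat 1 ((3 - golden) / 5) ((3 * golden - 4) / 5) 0"

lemmas chamber_defs = r0_def r1_def r2_def r3_def v0_def v1_def v2_def

lemma mirror_Quat: "mirror (Quat a b c d) (Quat a' b' c' d') =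
  (let t = 2 * (a' * a + b' * b + c' * c + d' * d)
   in Quat (a' - t * a) (b' - t * b) (c' - t * c) (d' - t * d))"
  by (simp add: mirror_def Quat_inner Quat_arith Let_def)

lemma r0_BD: "r0 \<in> BD" and r2_BD: "r2 \<in> BD"
proof -
  show "r0 \<in> BD"
    unfolding r0_def Quat_def
    by (rule half_turn_BD) (auto simp: norm_eq_1 inner_vec3 face_directions_iff)
  show "r2 \<in> BD"
    unfolding r2_def Quat_def
    by (rule half_turn_BD) (auto simp: norm_eq_1 inner_vec3 face_directions_iff)
qed

lemma r1_BD: "r1 \<in> BD"
proof -
  let ?u = "vector [(golden - 1) / 2, - 1 / 2, - golden / 2] :: real^3"
  have "(0, ?u) \<in> BD"
  proof (rule half_turn_BD)
    have "?u \<bullet> ?u = 1"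
      unfolding inner_vec3 vector_3 by (simp add: field_simps golden_mult)
    then show "norm ?u = 1" by (simp add: norm_eq_1)
    fix n :: "real^3" assume "n \<in> face_directions"
    then obtain s t :: real where s: "s \<in> {1, -1}" and t: "t = s \<or> t = - s"
      and n: "n = vector [s * dod_x, t * dod_y, 0] \<or> n = vector [0, s * dod_x, t * dod_y] \<or>
        n = vector [s * dod_y, 0, t * dod_x]"
      unfolding face_directions_def by fastforce
    have mem: "vector [a * dod_x, b * dod_y, 0] \<in> face_directions"
      "vector [0, a * dod_x, b * dod_y] \<in> face_directions"
      "vector [a * dod_y, 0, b * dod_x] \<in> face_directions"
      if "a = s \<or> a = - s" "b = s \<or> b = - s" for a b
      using that s dod_x_y_pos by (auto simp: face_directions_iff abs_mult)
    have "(2 * (?u \<bullet> n)) *\<^sub>R ?u - n \<in>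
      {vector [- s * dod_x, - s * dod_y, 0], vector [- s * dod_y, 0, - s * dod_x],
       vector [- s * dod_y, 0, s * dod_x], vector [0, - s * dod_x, s * dod_y],
       vector [- s * dod_x, s * dod_y, 0], vector [0, - s * dod_x, - s * dod_y]}"
      (is "?m \<in> _")
    proof -
      have eqI: "?m = vector [a, b, c]"
        if "2 * (?u \<bullet> n) * ((golden - 1) / 2) - n $ 1 = a" "2 * (?u \<bullet> n) * (- 1 / 2) - n $ 2 = b"
          "2 * (?u \<bullet> n) * (- golden / 2) - n $ 3 = c" for a b c
        using that by (intro vec3_eqI) simp_all
      consider
        "t = s" "n = vector [s * dod_x, t * dod_y, 0]" | "t = - s" "n = vector [s * dod_x, t * dod_y, 0]"
        | "t = s" "n = vector [0, s * dod_x, t * dod_y]" | "t = - s" "n = vector [0, s * dod_x, t * dod_y]"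
        | "t = s" "n = vector [s * dod_y, 0, t * dod_x]" | "t = - s" "n = vector [s * dod_y, 0, t * dod_x]"
        using t n by blast
      then show ?thesis
      proof cases
        case 1
        have "?m = vector [- s * dod_x, - s * dod_y, 0]"
          by (rule eqI) (simp_all add: 1 inner_vec3 dod_x_eq field_simps golden_mult)
        then show ?thesis by simp
      next
        case 2
        have "?m = vector [- s * dod_y, 0, - s * dod_x]"
          by (rule eqI) (simp_all add: 2 inner_vec3 dod_x_eq field_simps golden_mult)
        then show ?thesis by simp
      next
        case 3
        have "?m = vector [- s * dod_y, 0, s * dod_x]"
          by (rule eqI) (simp_all add: 3 inner_vec3 dod_x_eq field_simps golden_mult)
        then show ?thesis by simp
      next
        case 4
        have "?m = vector [0, - s * dod_x, s * dod_y]"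
          by (rule eqI) (simp_all add: 4 inner_vec3 dod_x_eq field_simps golden_mult)
        then show ?thesis by simp
      next
        case 5
        have "?m = vector [- s * dod_x, s * dod_y, 0]"
          by (rule eqI) (simp_all add: 5 inner_vec3 dod_x_eq field_simps golden_mult)
        then show ?thesis by simp
      next
        case 6
        have "?m = vector [0, - s * dod_x, - s * dod_y]"
          by (rule eqI) (simp_all add: 6 inner_vec3 dod_x_eq field_simps golden_mult)
        then show ?thesis by simp
      qed
    qed
    then show "?m \<in> face_directions" using mem[of "- s" s] mem[of "- s" "- s"] by auto
  qed
  then show ?thesis by (simp add: r1_def Quat_def)
qed

text \<open>The mirror of \<open>r1'\<close> swaps \<open>v0\<close> with the vertex opposite to the edge of \<open>v1\<close> in the
  pentagon with centre \<open>v2\<close>.\<close>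

definition r1' :: quat where "r1' = Quat 0 (- 1 / 2) (golden / 2) (- (golden - 1) / 2)"

lemma r1'_BD: "r1' \<in> BD"
proof -
  have "r1' = - mirror r0 (mirror r1 r0)"
    unfolding r1'_def r0_def r1_def mirror_Quat Let_def Quat_arith Quat_eq_iff
    by (simp add: field_simps golden_mult)
  then show ?thesis
    using BD_uminus[OF mirror_BD[OF r0_BD mirror_BD[OF r1_BD r0_BD]]] by simp
qed

lemma r3_BD: "r3 \<in> BD"
proof -
  have "r3 = r0 \<cdot>\<^sub>H r1'"
    unfolding r3_def r0_def r1'_def Quat_mult Quat_eq_iff by (simp add: field_simps)
  then show ?thesis using BD_mult[OF r0_BD r1'_BD] by simp
qed

lemma unit_quat_BD: "unit_quat \<in> BD"
  unfolding unit_quat_eq by (rule BD_one)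

lemma fst_inner_unit: "z \<bullet> unit_quat = fst z" "unit_quat \<bullet> z = fst z"
  by (simp_all add: unit_quat_eq inner_prod_def)

lemma fst_vertices: "fst v0 = 1" "fst v1 = 1" "fst v2 = 1" "fst unit_quat = 1"
  by (simp_all add: chamber_defs Quat_def)

lemma vertex_root_inner:
  "v0 \<bullet> r0 > 0" "v0 \<bullet> r1 = 0" "v0 \<bullet> r2 = 0" "v0 \<bullet> r3 = 0"
  "v1 \<bullet> r0 = 0" "v1 \<bullet> r1 > 0" "v1 \<bullet> r2 = 0" "v1 \<bullet> r3 = 0"
  "v2 \<bullet> r0 = 0" "v2 \<bullet> r1 = 0" "v2 \<bullet> r2 > 0" "v2 \<bullet> r3 = 0"
  "unit_quat \<bullet> r0 = 0" "unit_quat \<bullet> r1 = 0" "unit_quat \<bullet> r2 = 0" "unit_quat \<bullet> r3 > 0"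
proof -
  have "(golden - 1) * (2 - golden) > 0" using golden_bounds by (intro mult_pos_pos) auto
  then show "v1 \<bullet> r1 > 0" by (simp add: chamber_defs Quat_inner algebra_simps)
  show "v0 \<bullet> r0 > 0" "v2 \<bullet> r2 > 0" "unit_quat \<bullet> r3 > 0"
    using golden_bounds by (simp_all add: chamber_defs Quat_inner)
qed (simp_all add: chamber_defs Quat_inner field_simps golden_mult)

text \<open>The expansion of a vector in the basis dual, up to positive factors, to the simple roots.\<close>

lemma root_expansion:
  "z = ((3 * golden + 2) * (z \<bullet> r0)) *\<^sub>R v0 + ((4 * golden + 2) * (z \<bullet> r1)) *\<^sub>R v1
     + ((3 * golden + 1) * (z \<bullet> r2)) *\<^sub>R v2 + (2 * golden * (z \<bullet> r3)) *\<^sub>R unit_quat"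
proof -
  obtain a b c d where z: "z = Quat a b c d" by (rule Quat_exhaust)
  show ?thesis
    unfolding z chamber_defs Quat_inner Quat_arith Quat_eq_iff
    by (simp add: field_simps golden_mult)
qed

text \<open>The closed chamber: the vectors on the nonnegative side of all four mirrors.\<close>

definition chamber :: "quat set" where
  "chamber = {z. 0 \<le> z \<bullet> r0 \<and> 0 \<le> z \<bullet> r1 \<and> 0 \<le> z \<bullet> r2 \<and> 0 \<le> z \<bullet> r3}"

lemma chamber_combination:
  assumes "z \<in> chamber"
  obtains b0 b1 b2 b3 where "0 \<le> b0" "0 \<le> b1" "0 \<le> b2" "0 \<le> b3"
    "z = b0 *\<^sub>R v0 + b1 *\<^sub>R v1 + b2 *\<^sub>R v2 + b3 *\<^sub>R unit_quat" "fst z = b0 + b1 + b2 + b3"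
proof
  let ?b0 = "(3 * golden + 2) * (z \<bullet> r0)" and ?b1 = "(4 * golden + 2) * (z \<bullet> r1)"
    and ?b2 = "(3 * golden + 1) * (z \<bullet> r2)" and ?b3 = "2 * golden * (z \<bullet> r3)"
  show "0 \<le> ?b0" "0 \<le> ?b1" "0 \<le> ?b2" "0 \<le> ?b3"
    using assms golden_pos by (auto simp: chamber_def)
  show e: "z = ?b0 *\<^sub>R v0 + ?b1 *\<^sub>R v1 + ?b2 *\<^sub>R v2 + ?b3 *\<^sub>R unit_quat"
    by (rule root_expansion)
  have "fst (?b0 *\<^sub>R v0 + ?b1 *\<^sub>R v1 + ?b2 *\<^sub>R v2 + ?b3 *\<^sub>R unit_quat) = ?b0 + ?b1 + ?b2 + ?b3"
    by (simp add: fst_vertices)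
  then show "fst z = ?b0 + ?b1 + ?b2 + ?b3" using e by metis
qed

lemma vertices_in_chamber: "v0 \<in> chamber" "v1 \<in> chamber" "v2 \<in> chamber" "unit_quat \<in> chamber"
  using vertex_root_inner by (simp_all add: chamber_def)

text \<open>A vector in the interior of the chamber.\<close>

definition rho :: quat where
  "rho = v0 + v1 + v2 + unit_quat"

lemma rho_pos: "rho \<bullet> r0 > 0" "rho \<bullet> r1 > 0" "rho \<bullet> r2 > 0" "rho \<bullet> r3 > 0"
  unfolding rho_def inner_add_left using vertex_root_inner by linarith+

lemma outside_chamber:
  assumes "z \<notin> chamber"
  obtains r where "r \<in> BD" "r \<in> {r0, r1, r2, r3}" "z \<bullet> r < 0" "z \<bullet> rho < mirror r z \<bullet> rho"
proof -
  have "z \<bullet> r0 < 0 \<or> z \<bullet> r1 < 0 \<or> z \<bullet> r2 < 0 \<or> z \<bullet> r3 < 0"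
    using assms unfolding chamber_def by (simp only: mem_Collect_eq not_le de_Morgan_conj)
  then obtain r where r: "r \<in> {r0, r1, r2, r3}" "z \<bullet> r < 0"
    by blast
  then have "r \<in> BD" "rho \<bullet> r > 0"
    using r0_BD r1_BD r2_BD r3_BD rho_pos by auto
  moreover have "(z \<bullet> r) * (r \<bullet> rho) < 0"
    using r(2) \<open>rho \<bullet> r > 0\<close> by (subst inner_commute[of r rho]) (rule mult_neg_pos)
  then have "z \<bullet> rho < mirror r z \<bullet> rho" unfolding inner_mirror by linarith
  ultimately show thesis using that r by blast
qed

lemma finite_maximizer:
  fixes f :: "'a \<Rightarrow> real"
  assumes "finite S" "S \<noteq> {}"
  obtains x where "x \<in> S" "\<And>y. y \<in> S \<Longrightarrow> f y \<le> f x"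
proof -
  obtain x where "x \<in> S" "f x = Max (f ` S)"
    using Max_in[of "f ` S"] assms by fastforce
  then show thesis using that[of x] assms(1) by simp
qed

text \<open>
  An image of \<open>z\<close> is determined by its inner products with the simple roots, and these are inner
  products of \<open>z\<close> with group elements.
\<close>

lemma finite_orbit: "finite ((\<lambda>f. f z) ` BD_isometries)"
proof -
  let ?A = "(\<lambda>p. z \<bullet> p) ` BD"
  let ?F = "\<lambda>(a, b, c, d). ((3 * golden + 2) * a) *\<^sub>R v0 + ((4 * golden + 2) * b) *\<^sub>R v1
     + ((3 * golden + 1) * c) *\<^sub>R v2 + (2 * golden * d) *\<^sub>R unit_quat"
  have "f z \<in> ?F ` (?A \<times> ?A \<times> ?A \<times> ?A)" if f: "f \<in> BD_isometries" for f
  proof -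
    obtain g where g: "g \<in> BD_isometries" "\<And>x. f (g x) = x"
      using isometry_inverse[OF f] by metis
    have A: "f z \<bullet> p \<in> ?A" if "p \<in> BD" for p
    proof -
      have "f z \<bullet> p = z \<bullet> g p" using isometry_inner[OF f, of z "g p"] g(2) by simp
      then show ?thesis by (rule image_eqI) (rule isometry_BD[OF g(1) that])
    qed
    have "(f z \<bullet> r0, f z \<bullet> r1, f z \<bullet> r2, f z \<bullet> r3) \<in> ?A \<times> ?A \<times> ?A \<times> ?A"
      by (intro SigmaI A r0_BD r1_BD r2_BD r3_BD)
    moreover have "f z = ?F (f z \<bullet> r0, f z \<bullet> r1, f z \<bullet> r2, f z \<bullet> r3)"
      unfolding prod.case by (rule root_expansion)
    ultimately show ?thesis by (rule rev_image_eqI)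
  qed
  then have "(\<lambda>f. f z) ` BD_isometries \<subseteq> ?F ` (?A \<times> ?A \<times> ?A \<times> ?A)" by (rule image_subsetI)
  then show ?thesis
    by (rule finite_subset) (intro finite_imageI finite_cartesian_product finite_BD)
qed

text \<open>An element of the orbit with the largest inner product with \<open>rho\<close> lies in the chamber.\<close>

lemma to_chamber:
  obtains f where "f \<in> BD_isometries" "f z \<in> chamber"
proof -
  obtain w where w: "w \<in> (\<lambda>f. f z) ` BD_isometries"
    and max: "\<And>u. u \<in> (\<lambda>f. f z) ` BD_isometries \<Longrightarrow> u \<bullet> rho \<le> w \<bullet> rho"
    using finite_maximizer[OF finite_orbit[of z], of "\<lambda>u. u \<bullet> rho"] id_isometry by blast
  obtain f where f: "f \<in> BD_isometries" "w = f z" using w by blast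
  have "w \<in> chamber"
  proof (rule ccontr)
    assume "w \<notin> chamber"
    then obtain r where r: "r \<in> BD" "w \<bullet> rho < mirror r w \<bullet> rho" by (rule outside_chamber)
    have "mirror r \<circ> f \<in> BD_isometries" using f(1) r(1) by (simp add: comp_isometry mirror_isometry)
    then have "mirror r w \<in> (\<lambda>f. f z) ` BD_isometries"
      unfolding f(2) by (rule image_eqI[rotated]) simp
    from max[OF this] show False using r(2) by linarith
  qed
  then show thesis using that f by blast
qed

text \<open>
  The chamber is so narrow around \<open>unit_quat\<close> that no other element of the group fits in.
\<close>

lemma BD_chamber:
  assumes "p \<in> BD" "p \<in> chamber"
  shows "p = unit_quat"
proof -
  obtain b0 b1 b2 b3 where b: "0 \<le> b0" "0 \<le> b1" "0 \<le> b2" "0 \<le> b3"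
    and p: "p = b0 *\<^sub>R v0 + b1 *\<^sub>R v1 + b2 *\<^sub>R v2 + b3 *\<^sub>R unit_quat" "fst p = b0 + b1 + b2 + b3"
    using chamber_combination[OF assms(2)] .
  have le: "norm v \<le> 11 / 10" if "v \<bullet> v \<le> 121 / 100" for v :: quat
    by (subst norm_le_square) (use that in \<open>simp add: power2_eq_square\<close>)
  have "v0 \<bullet> v0 = 40 - 24 * golden" "v1 \<bullet> v1 = 6 - 3 * golden" "v2 \<bullet> v2 = (60 - 20 * golden) / 25"
    unfolding chamber_defs Quat_inner by (simp_all add: field_simps golden_mult)
  then have v: "norm v0 \<le> 11 / 10" "norm v1 \<le> 11 / 10" "norm v2 \<le> 11 / 10" "norm unit_quat \<le> 11 / 10"
    using golden_bounds by (intro le; simp add: Quat_inner)+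
  have "1 = norm p" using assms(1) by (simp add: BD_norm)
  also have "\<dots> \<le> norm (b0 *\<^sub>R v0) + norm (b1 *\<^sub>R v1) + norm (b2 *\<^sub>R v2) + norm (b3 *\<^sub>R unit_quat)"
    unfolding p(1) by (intro norm_triangle_mono order_refl)
  also have "\<dots> \<le> b0 * (11 / 10) + b1 * (11 / 10) + b2 * (11 / 10) + b3 * (11 / 10)"
    unfolding norm_scaleR abs_of_nonneg[OF b(1)] abs_of_nonneg[OF b(2)]
      abs_of_nonneg[OF b(3)] abs_of_nonneg[OF b(4)]
    by (intro add_mono mult_left_mono b v)
  finally have "107 / 125 \<le> fst p" using p(2) by simp
  then show ?thesis using BD_near_one[OF assms(1)] by (simp add: unit_quat_eq)
qed

text \<open>
  On the chamber the largest of the linear functionals given by the group elements is the real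
  part: reflecting \<open>p\<close> in a wall that separates it from the chamber increases \<open>p \<bullet> rho\<close> and does
  not decrease \<open>p \<bullet> z\<close>, and the only group element that no wall separates from the chamber is
  \<open>unit_quat\<close>.
\<close>

lemma chamber_inner_le:
  assumes "z \<in> chamber" "p \<in> BD"
  shows "p \<bullet> z \<le> fst z"
proof -
  let ?S = "{q \<in> BD. p \<bullet> z \<le> q \<bullet> z}"
  have "p \<in> ?S" using assms(2) by simp
  then have "finite ?S" "?S \<noteq> {}" using finite_BD by (simp, blast)
  then obtain q where q: "q \<in> ?S" and max: "\<And>u. u \<in> ?S \<Longrightarrow> u \<bullet> rho \<le> q \<bullet> rho"
    using finite_maximizer[of ?S "\<lambda>u. u \<bullet> rho"] by blast
  have "q \<in> chamber"
  proof (rule ccontr)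
    assume "q \<notin> chamber"
    then obtain r where r: "r \<in> BD" "r \<in> {r0, r1, r2, r3}" "q \<bullet> r < 0" "q \<bullet> rho < mirror r q \<bullet> rho"
      by (rule outside_chamber)
    have "0 \<le> r \<bullet> z" using r(2) assms(1) by (auto simp: chamber_def inner_commute)
    then have "(q \<bullet> r) * (r \<bullet> z) \<le> 0" using r(3) by (simp add: mult_nonpos_nonneg)
    then have "q \<bullet> z \<le> mirror r q \<bullet> z" unfolding inner_mirror by linarith
    then have "mirror r q \<in> ?S" using q mirror_BD[OF r(1)] by auto
    from max[OF this] show False using r(4) by linarith
  qed
  then have "q = unit_quat" using q BD_chamber by blast
  then show ?thesis using q by (simp add: fst_inner_unit)
qed

section \<open>The polytope with facet normals in the group\<close>

text \<open>
  The points whose inner product with every group element is at most \<open>c\<close>. The group element \<open>p\<close>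
  is the outer normal of the facet \<open>{z \<in> cell c. p \<bullet> z = c}\<close> if \<open>c > 0\<close>.
\<close>

definition cell :: "real \<Rightarrow> quat set" where
  "cell c = {z. \<forall>p\<in>BD. p \<bullet> z \<le> c}"

lemma cell_Inter: "cell c = (\<Inter>p\<in>BD. {z. p \<bullet> z \<le> c})"
  unfolding cell_def by (rule set_eqI) simp

lemma convex_cell: "convex (cell c)"
  unfolding cell_Inter by (intro convex_INT convex_halfspace_le)

lemma closed_cell: "closed (cell c)"
  unfolding cell_Inter by (intro closed_INT ballI closed_halfspace_le)

lemma cellD: "z \<in> cell c \<Longrightarrow> p \<in> BD \<Longrightarrow> p \<bullet> z \<le> c"
  unfolding cell_def by simp

lemma cellI: "(\<And>p. p \<in> BD \<Longrightarrow> p \<bullet> z \<le> c) \<Longrightarrow> z \<in> cell c"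
  unfolding cell_def by simp

lemma cell_uminus: "z \<in> cell c \<Longrightarrow> - z \<in> cell c"
proof (rule cellI)
  fix p assume "z \<in> cell c" "p \<in> BD"
  then show "p \<bullet> - z \<le> c" using cellD[of z c "- p"] BD_uminus by simp
qed

lemma cell_abs_le:
  assumes "z \<in> cell c" "p \<in> BD"
  shows "\<bar>z \<bullet> p\<bar> \<le> c"
proof -
  have "p \<bullet> z \<le> c" "p \<bullet> - z \<le> c"
    using cellD[OF assms] cellD[OF cell_uminus[OF assms(1)] assms(2)] .
  then show ?thesis unfolding inner_commute[of z p] inner_minus_right by linarith
qed

lemma compact_cell: "compact (cell c)"
proof -
  have "norm z \<le> norm v0 * ((3 * golden + 2) * c) + norm v1 * ((4 * golden + 2) * c)
      + norm v2 * ((3 * golden + 1) * c) + norm unit_quat * ((2 * golden) * c)"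
    if z: "z \<in> cell c" for z
  proof -
    have n: "norm ((t * (z \<bullet> r)) *\<^sub>R v) \<le> norm v * (t * c)" if "r \<in> BD" "0 < t" for r v :: quat and t
    proof -
      have "\<bar>t * (z \<bullet> r)\<bar> \<le> t * c"
        unfolding abs_mult using cell_abs_le[OF z that(1)] that(2) by (simp add: mult_left_mono)
      then show ?thesis unfolding norm_scaleR mult.commute[of "norm v"]
        by (rule mult_right_mono) simp
    qed
    have "norm z = norm (((3 * golden + 2) * (z \<bullet> r0)) *\<^sub>R v0 + ((4 * golden + 2) * (z \<bullet> r1)) *\<^sub>R v1
      + ((3 * golden + 1) * (z \<bullet> r2)) *\<^sub>R v2 + (2 * golden * (z \<bullet> r3)) *\<^sub>R unit_quat)"
      using root_expansion[of z] by (rule arg_cong)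
    also have "\<dots> \<le> norm v0 * ((3 * golden + 2) * c) + norm v1 * ((4 * golden + 2) * c)
      + norm v2 * ((3 * golden + 1) * c) + norm unit_quat * ((2 * golden) * c)"
      by (intro norm_triangle_mono n r0_BD r1_BD r2_BD r3_BD) (use golden_pos in simp_all)
    finally show ?thesis .
  qed
  then have "bounded (cell c)" by (rule boundedI)
  then show ?thesis using closed_cell compact_eq_bounded_closed by blast
qed

lemma isometry_cell:
  assumes "f \<in> BD_isometries" "z \<in> cell c"
  shows "f z \<in> cell c"
proof (rule cellI)
  fix p assume p: "p \<in> BD"
  obtain g where g: "g \<in> BD_isometries" "\<And>x. f (g x) = x"
    using isometry_inverse[OF assms(1)] by metis
  have "p \<bullet> f z = g p \<bullet> z" using isometry_inner[OF assms(1), of "g p" z] g(2) by simp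
  also have "\<dots> \<le> c" using assms(2) isometry_BD[OF g(1) p] by (rule cellD)
  finally show "p \<bullet> f z \<le> c" .
qed

lemma chamber_vertex_cell:
  assumes "v \<in> chamber" "fst v = 1" "0 \<le> c"
  shows "c *\<^sub>R v \<in> cell c"
proof (rule cellI)
  fix p assume "p \<in> BD"
  then have "p \<bullet> v \<le> 1" using chamber_inner_le[OF assms(1)] assms(2) by simp
  then show "p \<bullet> c *\<^sub>R v \<le> c" using assms(3) mult_left_mono[of "p \<bullet> v" 1 c] by simp
qed

lemma extreme_point_isometry:
  assumes f: "f \<in> BD_isometries" and z: "z extreme_point_of cell c"
  shows "f z extreme_point_of cell c"
  unfolding extreme_point_of_def
proof (intro conjI ballI notI)
  obtain g where g: "g \<in> BD_isometries" "\<And>x. g (f x) = x" "\<And>x. f (g x) = x"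
    using isometry_inverse[OF f] by metis
  show "f z \<in> cell c" using z isometry_cell[OF f] unfolding extreme_point_of_def by simp
  fix a b assume ab: "a \<in> cell c" "b \<in> cell c" "f z \<in> open_segment a b"
  then obtain t where t: "a \<noteq> b" "0 < t" "t < 1" "f z = (1 - t) *\<^sub>R a + t *\<^sub>R b"
    unfolding in_segment by metis
  have l: "linear g" using g(1) by (rule isometry_linear)
  have "z = g ((1 - t) *\<^sub>R a + t *\<^sub>R b)" using g(2)[of z] t(4) by simp
  also have "\<dots> = (1 - t) *\<^sub>R g a + t *\<^sub>R g b"
    by (simp add: linear_add[OF l] linear_scale[OF l])
  finally have "z \<in> open_segment (g a) (g b)"
    unfolding in_segment using t g(3) by metis
  then show False
    using z isometry_cell[OF g(1) ab(1)] isometry_cell[OF g(1) ab(2)]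
    unfolding extreme_point_of_def by simp
qed

text \<open>
  Modulo the isometries, an extreme point \<open>w\<close> lies in the chamber. There the polytope is the
  simplex with vertices \<open>0, c v0, c v1, c v2, c\<close>, and all of these but \<open>c v0\<close> are interior to
  segments in the polytope.
\<close>

lemma extreme_point_orbit:
  assumes c: "0 < c" and z: "z extreme_point_of cell c"
  obtains f where "f \<in> BD_isometries" "f z = c *\<^sub>R v0"
proof -
  obtain f where f: "f \<in> BD_isometries" "f z \<in> chamber" by (rule to_chamber)
  define w where "w = f z"
  have w: "w extreme_point_of cell c" unfolding w_def using f(1) z by (rule extreme_point_isometry)
  have cells: "c *\<^sub>R v0 \<in> cell c" "c *\<^sub>R v1 \<in> cell c" "c *\<^sub>R v2 \<in> cell c" "c *\<^sub>R unit_quat \<in> cell c"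
    using c by (intro chamber_vertex_cell vertices_in_chamber fst_vertices; simp)+
  have zero: "0 \<in> cell c" using c by (intro cellI) simp
  have w_cell: "w \<in> cell c" using w unfolding extreme_point_of_def by simp
  obtain b0 b1 b2 b3 where b: "0 \<le> b0" "0 \<le> b1" "0 \<le> b2" "0 \<le> b3"
    and e: "w = b0 *\<^sub>R v0 + b1 *\<^sub>R v1 + b2 *\<^sub>R v2 + b3 *\<^sub>R unit_quat" "fst w = b0 + b1 + b2 + b3"
    using chamber_combination[OF f(2), folded w_def] .
  have le: "b0 + b1 + b2 + b3 \<le> c"
    using cellD[OF w_cell unit_quat_BD] e(2) by (simp add: fst_inner_unit)
  have w_in: "w \<in> convex hull {0, c *\<^sub>R v0, c *\<^sub>R v1, c *\<^sub>R v2, c *\<^sub>R unit_quat}" (is "_ \<in> convex hull ?H")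
  proof -
    define y where "y = (\<lambda>i. [0, c *\<^sub>R v0, c *\<^sub>R v1, c *\<^sub>R v2, c *\<^sub>R unit_quat] ! i)"
    define a where "a = (\<lambda>i. [(c - (b0 + b1 + b2 + b3)) / c, b0 / c, b1 / c, b2 / c, b3 / c] ! i)"
    have I: "{..<5} = {0, 1, 2, 3, 4::nat}" by auto
    have "(\<Sum>i\<in>{0, 1, 2, 3, 4::nat}. a i *\<^sub>R y i) \<in> convex hull ?H"
    proof (rule convex_sum)
      show "sum a {0, 1, 2, 3, 4} = 1"
        using c by (simp add: a_def eval_nat_numeral add_divide_distrib[symmetric])
      show "0 \<le> a i" if "i \<in> {0, 1, 2, 3, 4}" for i
        using that b c le by (auto simp: a_def eval_nat_numeral)
      show "y i \<in> convex hull ?H" if "i \<in> {0, 1, 2, 3, 4}" for i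
      proof -
        have "y i \<in> ?H" using that by (elim insertE emptyE) (simp_all add: y_def eval_nat_numeral)
        then show ?thesis by (rule hull_inc)
      qed
    qed (simp_all add: convex_convex_hull)
    moreover have "(\<Sum>i\<in>{0, 1, 2, 3, 4::nat}. a i *\<^sub>R y i) = w"
      using c by (simp add: a_def y_def e(1) eval_nat_numeral)
    ultimately show ?thesis by simp
  qed
  have "?H \<subseteq> cell c" using cells zero by simp
  then have "convex hull ?H \<subseteq> cell c" using convex_cell by (rule hull_minimal)
  then have "w extreme_point_of convex hull ?H"
    using w w_in unfolding extreme_point_of_def by (meson subsetD)
  then have w_H: "w \<in> ?H" by (rule extreme_point_of_convex_hull)
  have no: False
    if "c *\<^sub>R x \<in> cell c" "c *\<^sub>R y \<in> cell c" "x \<noteq> y" "0 < t" "t < 1"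
      "w = c *\<^sub>R u" "u = (1 - t) *\<^sub>R x + t *\<^sub>R y" for x y u t
  proof -
    have "w = (1 - t) *\<^sub>R (c *\<^sub>R x) + t *\<^sub>R (c *\<^sub>R y)"
      unfolding that(6,7) by (simp add: scaleR_add_right mult.commute)
    moreover have "c *\<^sub>R x \<noteq> c *\<^sub>R y" using c that(3) by simp
    ultimately show False using w that unfolding extreme_point_of_def in_segment by metis
  qed
  have mirror_cell: "c *\<^sub>R mirror r v0 \<in> cell c" if "r \<in> BD" for r
  proof -
    have "mirror r (c *\<^sub>R v0) = c *\<^sub>R mirror r v0"
      by (simp add: mirror_def scaleR_diff_right)
    then show ?thesis using isometry_cell[OF mirror_isometry[OF that] cells(1)] by simp
  qed
  have "w = c *\<^sub>R v0"
  proof (rule ccontr)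
    assume "w \<noteq> c *\<^sub>R v0"
    then consider "w = c *\<^sub>R 0" | "w = c *\<^sub>R v1" | "w = c *\<^sub>R v2" | "w = c *\<^sub>R unit_quat"
      using w_H by (elim insertE emptyE) simp_all
    then show False
    proof cases
      case 1
      have "v0 \<noteq> - v0" by (simp add: v0_def Quat_arith Quat_eq_iff)
      moreover have "c *\<^sub>R (- v0) \<in> cell c" using cell_uminus[OF cells(1)] by simp
      ultimately show False using cells(1) 1 by (intro no[of v0 "- v0" "1 / 2" 0]) simp_all
    next
      case 2
      have "v0 \<noteq> mirror r0 v0" "v1 = (1 - 1 / 2) *\<^sub>R v0 + (1 / 2) *\<^sub>R mirror r0 v0"
        unfolding chamber_defs mirror_Quat Let_def Quat_arith Quat_eq_iff
        using golden_bounds by (simp_all add: field_simps)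
      then show False
        using no[OF cells(1) mirror_cell[OF r0_BD] _ _ _ 2, of "1 / 2"] by simp
    next
      case 3
      \<comment> \<open>The centre of a regular pentagon divides the segment from the midpoint of an edge to the
        opposite vertex at the parameter \<open>1 / \<surd>5\<close>, which is \<open>?t\<close>.\<close>
      let ?t = "(2 * golden - 1) / 5"
      have "v1 \<noteq> mirror r1' v0" "v2 = (1 - ?t) *\<^sub>R v1 + ?t *\<^sub>R mirror r1' v0"
        unfolding chamber_defs r1'_def mirror_Quat Let_def Quat_arith Quat_eq_iff
        using golden_bounds by (simp_all add: field_simps golden_mult)
      moreover have "0 < ?t" "?t < 1" using golden_bounds by simp_all
      ultimately show False
        using no[OF cells(2) mirror_cell[OF r1'_BD] _ _ _ 3, of ?t] by metis
    next
      case 4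
      have "v0 \<noteq> - mirror unit_quat v0"
        "unit_quat = (1 - 1 / 2) *\<^sub>R v0 + (1 / 2) *\<^sub>R (- mirror unit_quat v0)"
        unfolding chamber_defs mirror_Quat Let_def Quat_arith Quat_eq_iff
        using golden_bounds by (simp_all add: field_simps)
      moreover have "c *\<^sub>R (- mirror unit_quat v0) \<in> cell c"
        using cell_uminus[OF mirror_cell[OF unit_quat_BD]] by simp
      moreover have "(0 :: real) < 1 / 2" "(1 / 2 :: real) < 1" by simp_all
      ultimately show False
        using no[OF cells(1) _ _ _ _ 4, of "- mirror unit_quat v0" "1 / 2"] by metis
    qed
  qed
  then show thesis using that f(1) w_def by simp
qed

text \<open>The isometries permute the extreme points transitively, so the polytope is the hull of one orbit.\<close>

lemma cell_hull:
  assumes c: "0 < c"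
  shows "cell c = convex hull ((\<lambda>f. c *\<^sub>R f v0) ` BD_isometries)"
proof
  have "cell c = convex hull {x. x extreme_point_of cell c}"
    using compact_cell convex_cell by (rule Krein_Milman_Minkowski)
  also have "\<dots> \<subseteq> convex hull ((\<lambda>f. c *\<^sub>R f v0) ` BD_isometries)"
  proof (rule hull_mono, rule subsetI)
    fix x assume "x \<in> {x. x extreme_point_of cell c}"
    then obtain f where f: "f \<in> BD_isometries" "f x = c *\<^sub>R v0"
      using extreme_point_orbit[OF c] by blast
    obtain g where g: "g \<in> BD_isometries" "\<And>y. g (f y) = y"
      using isometry_inverse[OF f(1)] by metis
    have "x = c *\<^sub>R g v0"
      using g(2)[of x] f(2) linear_scale[OF isometry_linear[OF g(1)], of c v0] by simp
    then show "x \<in> (\<lambda>f. c *\<^sub>R f v0) ` BD_isometries" using g(1) by (rule image_eqI)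
  qed
  finally show "cell c \<subseteq> convex hull ((\<lambda>f. c *\<^sub>R f v0) ` BD_isometries)" .
  show "convex hull ((\<lambda>f. c *\<^sub>R f v0) ` BD_isometries) \<subseteq> cell c"
  proof (rule hull_minimal, rule image_subsetI)
    fix f assume f: "f \<in> BD_isometries"
    have "c *\<^sub>R v0 \<in> cell c"
      using c by (intro chamber_vertex_cell vertices_in_chamber fst_vertices) simp
    from isometry_cell[OF f this] show "c *\<^sub>R f v0 \<in> cell c"
      by (simp add: linear_scale[OF isometry_linear[OF f]])
  qed (rule convex_cell)
qed

section \<open>The 120-cell as an intersection of half-spaces\<close>

lemma Vor_iff:
  assumes "q \<in> BD"
  shows "r \<in> Vor q \<longleftrightarrow> norm r = 1 \<and> (\<forall>p\<in>BD. p \<bullet> r \<le> q \<bullet> r)"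
proof -
  have "dist_S q r \<le> dist_S p r \<longleftrightarrow> p \<bullet> r \<le> q \<bullet> r" if r: "norm r = 1" and p: "p \<in> BD" for p
  proof -
    have "\<bar>u \<bullet> r\<bar> \<le> 1" if "u \<in> BD" for u
      using Cauchy_Schwarz_ineq2[of u r] r BD_norm[OF that] by simp
    then show ?thesis unfolding dist_S_def using assms p by (intro arccos_le_mono)
  qed
  then show ?thesis unfolding Vor_def by auto
qed

lemma norm_v0_pos: "norm v0 > 0"
  using fst_vertices(1) by auto

text \<open>
  Radial projection matches the vertices of the Voronoi cell of \<open>q\<close> with the extreme points of
  the polytope on its facet with normal \<open>q\<close>.
\<close>

lemma Voronoi_vertex_extreme:
  assumes q: "q \<in> BD" and v: "spherical_vertex_of v (Vor q)"
  shows "0 < q \<bullet> v \<and> (1 / (q \<bullet> v)) *\<^sub>R v extreme_point_of cell 1"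
proof -
  obtain a where a: "Vor q \<subseteq> {r. a \<bullet> r \<le> 0}" "Vor q \<inter> {r. a \<bullet> r = 0} = {v}"
    using v unfolding spherical_vertex_of_def by blast
  have vV: "v \<in> Vor q" "a \<bullet> v = 0" using a(2) by blast+
  have le: "p \<bullet> v \<le> q \<bullet> v" if "p \<in> BD" for p
    using vV(1) that unfolding Vor_iff[OF q] by simp
  have nv: "norm v = 1" using vV(1) unfolding Vor_iff[OF q] by simp
  have pos: "0 < q \<bullet> v"
  proof (rule ccontr)
    assume n: "\<not> 0 < q \<bullet> v"
    have "v \<bullet> p = 0" if "p \<in> BD" for p
      using le[OF that] le[OF BD_uminus[OF that]] n by (simp add: inner_commute)
    then have "v = 0"
      using root_expansion[of v] r0_BD r1_BD r2_BD r3_BD by simp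
    then show False using nv by simp
  qed
  define z where "z = (1 / (q \<bullet> v)) *\<^sub>R v"
  have qz: "q \<bullet> z = 1" and az: "a \<bullet> z = 0" using pos vV(2) by (simp_all add: z_def)
  have z: "z \<in> cell 1"
    by (rule cellI) (use le pos in \<open>simp add: z_def\<close>)
  have on_facet: "a \<bullet> x \<le> 0" "a \<bullet> x = 0 \<Longrightarrow> x = z" if x: "x \<in> cell 1" "q \<bullet> x = 1" for x
  proof -
    have nx: "0 < norm x" using x(2) by auto
    have "(1 / norm x) *\<^sub>R x \<in> Vor q"
      unfolding Vor_iff[OF q] using nx x cellD[OF x(1)] by (simp add: divide_right_mono)
    then have "a \<bullet> (1 / norm x) *\<^sub>R x \<le> 0" "a \<bullet> x = 0 \<Longrightarrow> (1 / norm x) *\<^sub>R x = v"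
      using a by auto
    then show "a \<bullet> x \<le> 0" using nx by (simp add: divide_le_0_iff)
    assume "a \<bullet> x = 0"
    then have e: "v = (1 / norm x) *\<^sub>R x" using \<open>a \<bullet> x = 0 \<Longrightarrow> (1 / norm x) *\<^sub>R x = v\<close> by simp
    have "q \<bullet> v = 1 / norm x" using x(2) by (simp add: e)
    then show "x = z" using nx by (simp add: z_def e)
  qed
  have False if xy: "x \<in> cell 1" "y \<in> cell 1" "z \<in> open_segment x y" for x y
  proof -
    obtain t where t: "x \<noteq> y" "0 < t" "t < 1" "z = (1 - t) *\<^sub>R x + t *\<^sub>R y"
      using xy(3) unfolding in_segment by metis
    have both: "\<alpha> = 0 \<and> \<beta> = 0" if "(1 - t) * \<alpha> + t * \<beta> = 0" "\<alpha> \<le> 0" "\<beta> \<le> 0" for \<alpha> \<beta>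
    proof -
      have "(1 - t) * \<alpha> \<le> 0" "t * \<beta> \<le> 0" using that(2,3) t by (auto intro: mult_nonneg_nonpos)
      then have "(1 - t) * \<alpha> = 0" "t * \<beta> = 0" using that(1) by linarith+
      then show ?thesis using t by simp
    qed
    have "(1 - t) * (q \<bullet> x - 1) + t * (q \<bullet> y - 1) = q \<bullet> z - 1"
      by (simp add: t(4) inner_add_right algebra_simps)
    then have q1: "q \<bullet> x = 1" "q \<bullet> y = 1"
      using both[of "q \<bullet> x - 1" "q \<bullet> y - 1"] qz cellD[OF xy(1) q] cellD[OF xy(2) q] by simp_all
    have "(1 - t) * (a \<bullet> x) + t * (a \<bullet> y) = a \<bullet> z"
      by (simp add: t(4) inner_add_right)
    then have a0: "a \<bullet> x = 0" "a \<bullet> y = 0"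
      using both[of "a \<bullet> x" "a \<bullet> y"] az on_facet(1)[OF xy(1) q1(1)] on_facet(1)[OF xy(2) q1(2)] by simp_all
    have "x = z" using xy(1) q1(1) a0(1) by (rule on_facet(2))
    moreover have "y = z" using xy(2) q1(2) a0(2) by (rule on_facet(2))
    ultimately show False using t(1) by simp
  qed
  then show ?thesis using pos z unfolding extreme_point_of_def z_def[symmetric] by metis
qed

text \<open>The group elements whose facets contain \<open>v0\<close>; besides \<open>unit_quat\<close> these are \<open>t1, t2, t3\<close>.\<close>

definition t1 :: quat where "t1 = Quat (golden / 2) (1 / 2) ((golden - 1) / 2) 0"
definition t2 :: quat where "t2 = Quat (golden / 2) (1 / 2) (- (golden - 1) / 2) 0"
definition t3 :: quat where "t3 = Quat (golden / 2) ((golden - 1) / 2) 0 (1 / 2)"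

lemma t_diff:
  "unit_quat - t1 = (golden - 1) *\<^sub>R r3" "t1 - t2 = (golden - 1) *\<^sub>R r2" "t2 - t3 = (golden - 1) *\<^sub>R r1"
  unfolding t1_def t2_def t3_def chamber_defs Quat_arith Quat_eq_iff
  by (simp_all add: field_simps golden_mult)

lemma t_BD: "t1 \<in> BD" "t2 \<in> BD" "t3 \<in> BD"
proof -
  have "mirror r3 unit_quat = t1" "mirror r2 t1 = t2" "mirror r1 t2 = t3"
    unfolding t1_def t2_def t3_def chamber_defs mirror_Quat Let_def Quat_eq_iff
    by (simp_all add: field_simps golden_mult)
  then show "t1 \<in> BD" "t2 \<in> BD" "t3 \<in> BD"
    using mirror_BD r1_BD r2_BD r3_BD unit_quat_BD by metis+
qed

lemma t_v0: "t1 \<bullet> v0 = 1" "t2 \<bullet> v0 = 1" "t3 \<bullet> v0 = 1" "unit_quat \<bullet> v0 = 1"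
  unfolding t1_def t2_def t3_def v0_def Quat_inner by (simp_all add: field_simps golden_mult)

lemma v0_cell: "v0 \<in> cell 1"
  using chamber_vertex_cell[OF vertices_in_chamber(1) fst_vertices(1), of 1] by simp

text \<open>The facets with normals \<open>unit_quat, t1, t2, t3\<close> have only \<open>v0\<close> in common.\<close>

lemma ray_v0:
  assumes "t1 \<bullet> s = unit_quat \<bullet> s" "t2 \<bullet> s = unit_quat \<bullet> s" "t3 \<bullet> s = unit_quat \<bullet> s"
  shows "s = (unit_quat \<bullet> s) *\<^sub>R v0"
proof -
  have g: "golden - 1 \<noteq> 0" using golden_bounds by simp
  have "(golden - 1) * (s \<bullet> r3) = (unit_quat - t1) \<bullet> s" "(golden - 1) * (s \<bullet> r2) = (t1 - t2) \<bullet> s"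
    "(golden - 1) * (s \<bullet> r1) = (t2 - t3) \<bullet> s"
    unfolding t_diff by (simp_all add: inner_commute)
  then have z: "s \<bullet> r1 = 0" "s \<bullet> r2 = 0" "s \<bullet> r3 = 0"
    using assms g unfolding inner_diff_left by auto
  have e: "s = ((3 * golden + 2) * (s \<bullet> r0)) *\<^sub>R v0"
    using root_expansion[of s] unfolding z by simp
  have "unit_quat \<bullet> s = (3 * golden + 2) * (s \<bullet> r0)"
    by (subst e) (simp add: t_v0)
  then show ?thesis using e by simp
qed

lemma Voronoi_vertex_v0:
  assumes f: "f \<in> BD_isometries"
  shows "spherical_vertex_of ((1 / norm v0) *\<^sub>R f v0) (Vor (f unit_quat))"
proof -
  define q where "q = f unit_quat"
  define v where "v = (1 / norm v0) *\<^sub>R f v0"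
  \<comment> \<open>On \<open>Vor q\<close> no \<open>f t1\<close>, \<open>f t2\<close>, \<open>f t3\<close> has a larger inner product than \<open>q\<close>, and all three
    attain that of \<open>q\<close> only on the ray through \<open>f v0\<close>.\<close>
  define a where "a = f t1 + f t2 + f t3 - 3 *\<^sub>R q"
  obtain g where g: "g \<in> BD_isometries" "\<And>x. g (f x) = x" "\<And>x. f (g x) = x"
    using isometry_inverse[OF f] by metis
  have inner_f: "f p \<bullet> r = p \<bullet> g r" for p r
    using isometry_inner[OF f, of p "g r"] g(3) by simp
  have q: "q \<in> BD" unfolding q_def using f unit_quat_BD by (rule isometry_BD)
  have tB: "f t1 \<in> BD" "f t2 \<in> BD" "f t3 \<in> BD" using isometry_BD[OF f] t_BD by simp_all
  have ar: "a \<bullet> r = (f t1 \<bullet> r - q \<bullet> r) + (f t2 \<bullet> r - q \<bullet> r) + (f t3 \<bullet> r - q \<bullet> r)" for r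
    by (simp add: a_def inner_diff_left inner_add_left)
  have le: "f t1 \<bullet> r \<le> q \<bullet> r" "f t2 \<bullet> r \<le> q \<bullet> r" "f t3 \<bullet> r \<le> q \<bullet> r" if "r \<in> Vor q" for r
    using that tB unfolding Vor_iff[OF q] by simp_all
  have "a \<bullet> q \<noteq> 0"
  proof -
    have "f t1 \<bullet> q = golden / 2" "f t2 \<bullet> q = golden / 2" "f t3 \<bullet> q = golden / 2" "q \<bullet> q = 1"
      unfolding q_def isometry_inner[OF f] t1_def t2_def t3_def Quat_inner by simp_all
    then show ?thesis unfolding ar using golden_bounds by simp
  qed
  then have a0: "a \<noteq> 0" by auto
  have sub: "Vor q \<subseteq> {r. a \<bullet> r \<le> 0}"
  proof (rule subsetI)
    fix r assume r: "r \<in> Vor q"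
    have "a \<bullet> r \<le> 0" unfolding ar using le[OF r] by linarith
    then show "r \<in> {r. a \<bullet> r \<le> 0}" by simp
  qed
  have nv: "norm v = 1" using norm_v0_pos isometry_norm[OF f] by (simp add: v_def)
  have vV: "v \<in> Vor q"
    unfolding Vor_iff[OF q]
  proof (intro conjI ballI nv)
    fix p assume p: "p \<in> BD"
    have "p \<bullet> f v0 = g p \<bullet> v0" using isometry_inner[OF f, of "g p" v0] g(3) by simp
    also have "\<dots> \<le> 1" using v0_cell isometry_BD[OF g(1) p] by (rule cellD)
    also have "1 = q \<bullet> f v0" unfolding q_def isometry_inner[OF f] by (simp only: t_v0)
    finally show "p \<bullet> v \<le> q \<bullet> v" using norm_v0_pos by (simp add: v_def divide_right_mono)
  qed
  have av: "a \<bullet> v = 0"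
    unfolding ar v_def q_def inner_scaleR_right isometry_inner[OF f] t_v0 by simp
  have only: "r = v" if r: "r \<in> Vor q" "a \<bullet> r = 0" for r
  proof -
    have "f t1 \<bullet> r = q \<bullet> r" "f t2 \<bullet> r = q \<bullet> r" "f t3 \<bullet> r = q \<bullet> r"
      using r(2) le[OF r(1)] unfolding ar by linarith+
    then have "g r = (unit_quat \<bullet> g r) *\<^sub>R v0"
      unfolding q_def inner_f by (rule ray_v0)
    then obtain k where k: "k = unit_quat \<bullet> g r" "g r = k *\<^sub>R v0" by blast
    have "- q \<bullet> r \<le> q \<bullet> r" using r(1) BD_uminus[OF q] unfolding Vor_iff[OF q] by blast
    then have "0 \<le> q \<bullet> r" by simp
    then have k0: "0 \<le> k" unfolding k(1) q_def inner_f .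
    have "norm (g r) = 1" using r(1) isometry_norm[OF g(1)] unfolding Vor_iff[OF q] by simp
    then have "k = 1 / norm v0" using k(2) k0 norm_v0_pos by (simp add: field_simps)
    moreover have "r = k *\<^sub>R f v0"
      using g(3)[of r] k(2) linear_scale[OF isometry_linear[OF f]] by metis
    ultimately show ?thesis by (simp add: v_def)
  qed
  have "Vor q \<inter> {r. a \<bullet> r = 0} = {v}"
    using vV av only by blast
  then show ?thesis
    unfolding spherical_vertex_of_def q_def[symmetric] v_def[symmetric] using a0 sub by metis
qed

lemma T120_vertices_eq: "T120_vertices = (\<lambda>f. (1 / norm v0) *\<^sub>R f v0) ` BD_isometries"
proof (rule set_eqI, rule iffI)
  fix v assume "v \<in> T120_vertices"
  then obtain q where q: "q \<in> BD" "spherical_vertex_of v (Vor q)"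
    unfolding T120_vertices_def by blast
  define k where "k = q \<bullet> v"
  have k: "0 < k" and ext: "(1 / k) *\<^sub>R v extreme_point_of cell 1"
    using Voronoi_vertex_extreme[OF q] unfolding k_def by simp_all
  obtain f where f: "f \<in> BD_isometries" "f ((1 / k) *\<^sub>R v) = 1 *\<^sub>R v0"
    using extreme_point_orbit[OF _ ext] by auto
  obtain g where g: "g \<in> BD_isometries" "\<And>y. g (f y) = y"
    using isometry_inverse[OF f(1)] by metis
  have e: "(1 / k) *\<^sub>R v = g v0" using g(2)[of "(1 / k) *\<^sub>R v"] f(2) by simp
  have "norm v = 1"
  proof -
    have "v \<in> Vor q" using q(2) unfolding spherical_vertex_of_def by blast
    then show ?thesis unfolding Vor_iff[OF q(1)] by simp
  qed
  moreover have "norm ((1 / k) *\<^sub>R v) = norm v0" unfolding e using g(1) by (rule isometry_norm)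
  ultimately have "norm v0 = 1 / k" using k by simp
  then have "v = (1 / norm v0) *\<^sub>R g v0" using k by (simp flip: e)
  then show "v \<in> (\<lambda>f. (1 / norm v0) *\<^sub>R f v0) ` BD_isometries" using g(1) by (rule image_eqI)
next
  fix v assume "v \<in> (\<lambda>f. (1 / norm v0) *\<^sub>R f v0) ` BD_isometries"
  then obtain f where f: "f \<in> BD_isometries" "v = (1 / norm v0) *\<^sub>R f v0" by (elim imageE)
  show "v \<in> T120_vertices"
    unfolding T120_vertices_def f(2)
    using Voronoi_vertex_v0[OF f(1)] isometry_BD[OF f(1) unit_quat_BD] by blast
qed

lemma cell120_eq: "cell120 = cell (1 / norm v0)"
  unfolding cell120_def T120_vertices_eq using norm_v0_pos by (intro cell_hull[symmetric]) simp

lemma polytope_cell120: "polytope cell120"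
proof -
  have "finite T120_vertices"
    unfolding T120_vertices_eq using finite_imageI[OF finite_orbit[of v0], of "\<lambda>x. (1 / norm v0) *\<^sub>R x"]
    by (simp add: image_image)
  then show ?thesis unfolding cell120_def polytope_def by blast
qed

section \<open>Faces and flags\<close>

text \<open>
  A nonempty face of a polyhedron is cut out by those of the defining inequalities that are
  equalities on it: a point in its relative interior satisfies the others strictly, so it also
  lies in the relative interior of the set cut out by these equalities.
\<close>

lemma face_of_polyhedron_tight:
  fixes B :: "'a::euclidean_space set"
  defines "C c \<equiv> {z. \<forall>p\<in>B. p \<bullet> z \<le> c}"
  assumes B: "finite B" and Q: "Q face_of C c" "Q \<noteq> {}"
  shows "Q = {z \<in> C c. \<forall>p\<in>{p \<in> B. \<forall>x\<in>Q. p \<bullet> x = c}. p \<bullet> z = c}"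
proof -
  define T where "T = {p \<in> B. \<forall>x\<in>Q. p \<bullet> x = c}"
  define K where "K = {z \<in> C c. \<forall>p\<in>T. p \<bullet> z = c}"
  have conv: "convex (C c)"
  proof -
    have "C c = (\<Inter>p\<in>B. {z. p \<bullet> z \<le> c})" unfolding C_def by auto
    then show ?thesis by (simp add: convex_INT convex_halfspace_le)
  qed
  have QC: "Q \<subseteq> C c" using Q(1) by (rule face_of_imp_subset)
  obtain x where x: "x \<in> rel_interior Q"
    using rel_interior_eq_empty[OF face_of_imp_convex[OF Q(1)]] Q(2) by blast
  have xQ: "x \<in> Q" using x rel_interior_subset by blast
  have strict: "p \<bullet> x < c" if p: "p \<in> B - T" for p
  proof (rule ccontr)
    assume "\<not> p \<bullet> x < c"
    moreover have "p \<bullet> x \<le> c" using p xQ QC unfolding C_def by blast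
    ultimately have eq: "p \<bullet> x = c" by linarith
    have face: "C c \<inter> {z. p \<bullet> z = c} face_of C c"
    proof (rule face_of_Int_supporting_hyperplane_le[OF conv])
      show "p \<bullet> z \<le> c" if "z \<in> C c" for z
        using that p unfolding C_def by blast
    qed
    have "x \<in> C c \<inter> {z. p \<bullet> z = c} \<inter> rel_interior Q"
      by (intro IntI CollectI eq x subsetD[OF QC xQ])
    then have "C c \<inter> {z. p \<bullet> z = c} \<inter> rel_interior Q \<noteq> {}" by (metis empty_iff)
    from subset_of_face_of[OF face QC this] have "p \<bullet> y = c" if "y \<in> Q" for y using that by blast
    then show False using p unfolding T_def by simp
  qed
  have "x \<in> rel_interior K"
    unfolding mem_rel_interior
  proof (intro exI conjI)
    show "open (\<Inter>p\<in>B - T. {z. p \<bullet> z < c})"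
      using B by (intro open_INT ballI open_halfspace_lt) simp
    show "x \<in> (\<Inter>p\<in>B - T. {z. p \<bullet> z < c}) \<inter> K"
    proof (intro IntI INT_I CollectI)
      show "p \<bullet> x < c" if "p \<in> B - T" for p using that by (rule strict)
      show "x \<in> K" using subsetD[OF QC xQ] xQ unfolding K_def T_def by simp
    qed
    have "affine hull K \<subseteq> (\<Inter>p\<in>T. {z. p \<bullet> z = c})"
    proof (rule hull_minimal)
      show "K \<subseteq> (\<Inter>p\<in>T. {z. p \<bullet> z = c})" unfolding K_def by blast
      show "affine (\<Inter>p\<in>T. {z. p \<bullet> z = c})"
      proof (rule affine_Inter)
        fix S assume "S \<in> (\<lambda>p. {z. p \<bullet> z = c}) ` T"
        then show "affine S" by (elim imageE) (simp add: affine_hyperplane)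
      qed
    qed
    moreover have "z \<in> K" if z: "z \<in> (\<Inter>p\<in>B - T. {z. p \<bullet> z < c})" "z \<in> (\<Inter>p\<in>T. {z. p \<bullet> z = c})" for z
    proof -
      have "p \<bullet> z \<le> c" if "p \<in> B" for p
        using z that by (cases "p \<in> T") (simp_all add: less_imp_le)
      then show ?thesis using z(2) unfolding K_def C_def by simp
    qed
    ultimately show "(\<Inter>p\<in>B - T. {z. p \<bullet> z < c}) \<inter> affine hull K \<subseteq> K"
      by (meson IntE subsetD subsetI)
  qed
  then have "Q \<inter> rel_interior K \<noteq> {}" using xQ by (metis IntI empty_iff)
  moreover have "K \<subseteq> C c" unfolding K_def by simp
  ultimately have "K \<subseteq> Q"
    using subset_of_face_of[OF Q(1), of K] by simp
  moreover have "y \<in> K" if "y \<in> Q" for y using subsetD[OF QC that] that unfolding K_def T_def by simp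
  ultimately have "Q = K" by (meson subsetI subset_antisym)
  then show ?thesis unfolding K_def T_def .
qed

text \<open>
  The four elements have the sum \<open>(1 + 3 golden / 2) v0\<close>. Any other group element has with each of
  them an inner product below \<open>107 / 125\<close>, and four times that is less than \<open>1 + 3 golden / 2\<close>.
\<close>

lemma tight_v0: "{p \<in> BD. p \<bullet> v0 = 1} = {unit_quat, t1, t2, t3}"
proof (rule equalityI; rule subsetI)
  fix p assume "p \<in> {p \<in> BD. p \<bullet> v0 = 1}"
  then have p: "p \<in> BD" "p \<bullet> v0 = 1" by simp_all
  have "unit_quat + t1 + t2 + t3 = (1 + 3 * golden / 2) *\<^sub>R v0"
    unfolding t1_def t2_def t3_def v0_def Quat_arith Quat_eq_iff by (simp add: field_simps golden_mult)
  then have "p \<bullet> unit_quat + p \<bullet> t1 + p \<bullet> t2 + p \<bullet> t3 = 1 + 3 * golden / 2"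
    unfolding inner_add_right[symmetric] using p(2) by simp
  then have "107 / 125 \<le> p \<bullet> unit_quat \<or> 107 / 125 \<le> p \<bullet> t1 \<or> 107 / 125 \<le> p \<bullet> t2 \<or> 107 / 125 \<le> p \<bullet> t3"
    using golden_bounds by linarith
  then have "p = unit_quat \<or> p = t1 \<or> p = t2 \<or> p = t3"
    using BD_separated[OF p(1)] t_BD unit_quat_BD by metis
  then show "p \<in> {unit_quat, t1, t2, t3}" by simp
next
  fix p assume "p \<in> {unit_quat, t1, t2, t3}"
  then have "p = unit_quat \<or> p = t1 \<or> p = t2 \<or> p = t3" by simp
  then show "p \<in> {p \<in> BD. p \<bullet> v0 = 1}"
    using t_BD unit_quat_BD t_v0 by (elim disjE) simp_all
qed

lemma tight_inner:
  assumes "a \<in> {unit_quat, t1, t2, t3}" "b \<in> {unit_quat, t1, t2, t3}" "a \<noteq> b"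
  shows "a \<bullet> b = golden / 2"
proof -
  have "unit_quat \<bullet> t1 = golden / 2" "unit_quat \<bullet> t2 = golden / 2" "unit_quat \<bullet> t3 = golden / 2"
    "t1 \<bullet> t2 = golden / 2" "t1 \<bullet> t3 = golden / 2" "t2 \<bullet> t3 = golden / 2"
    unfolding t1_def t2_def t3_def Quat_inner by (simp_all add: field_simps golden_mult)
  then show ?thesis using assms by (metis inner_commute insertE singletonD)
qed

lemma card_tight: "card {unit_quat, t1, t2, t3} = 4"
proof -
  have "golden \<noteq> 1" "golden \<noteq> 2" using golden_bounds by simp_all
  then show ?thesis
    unfolding t1_def t2_def t3_def by (simp add: card_insert_if Quat_eq_iff)
qed

text \<open>
  Any two of the four elements are exchanged by the reflection along their difference, which is a
  multiple of a group element; it fixes the other two.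
\<close>

lemma tight_root:
  assumes "a \<in> {unit_quat, t1, t2, t3}" "b \<in> {unit_quat, t1, t2, t3}" "a \<noteq> b"
  shows "golden *\<^sub>R (a - b) \<in> BD"
proof -
  have e1: "golden *\<^sub>R (unit_quat - t1) = r3" "golden *\<^sub>R (t1 - t2) = r2" "golden *\<^sub>R (t2 - t3) = r1"
    unfolding t_diff by (simp_all add: algebra_simps golden_mult)
  have e2: "mirror r2 r3 = r3 + r2" "mirror r1 r2 = r2 + r1" "mirror r1 (r3 + r2) = r3 + r2 + r1"
    unfolding chamber_defs Quat_arith mirror_Quat Let_def Quat_eq_iff by (simp_all add: field_simps golden_mult)
  have s: "golden *\<^sub>R (unit_quat - t2) = r3 + r2" "golden *\<^sub>R (t1 - t3) = r2 + r1"
    "golden *\<^sub>R (unit_quat - t3) = r3 + r2 + r1"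
    unfolding e1[symmetric] by (simp_all add: algebra_simps)
  have m: "r3 + r2 \<in> BD" "r2 + r1 \<in> BD"
    using mirror_BD[OF r2_BD r3_BD] mirror_BD[OF r1_BD r2_BD] unfolding e2 .
  have "r3 + r2 + r1 \<in> BD"
    using mirror_BD[OF r1_BD m(1)] unfolding e2 .
  then have pos: "golden *\<^sub>R (unit_quat - t1) \<in> BD" "golden *\<^sub>R (unit_quat - t2) \<in> BD"
    "golden *\<^sub>R (unit_quat - t3) \<in> BD" "golden *\<^sub>R (t1 - t2) \<in> BD" "golden *\<^sub>R (t1 - t3) \<in> BD"
    "golden *\<^sub>R (t2 - t3) \<in> BD"
    unfolding e1 s using m r1_BD r2_BD r3_BD by simp_all
  have neg: "golden *\<^sub>R (y - x) \<in> BD" if "golden *\<^sub>R (x - y) \<in> BD" for x y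
    using BD_uminus[OF that] by (simp flip: scaleR_minus_right)
  have "a = unit_quat \<or> a = t1 \<or> a = t2 \<or> a = t3" "b = unit_quat \<or> b = t1 \<or> b = t2 \<or> b = t3"
    using assms by simp_all
  then show ?thesis using assms(3) pos pos[THEN neg] by metis
qed

lemma tight_swap:
  assumes "a \<in> {unit_quat, t1, t2, t3}" "b \<in> {unit_quat, t1, t2, t3}"
  obtains f where "f \<in> BD_isometries" "f v0 = v0" "f a = b"
    "\<And>t. t \<in> {unit_quat, t1, t2, t3} \<Longrightarrow> t \<noteq> a \<Longrightarrow> t \<noteq> b \<Longrightarrow> f t = t"
proof (cases "a = b")
  case True
  then show thesis using that[of "\<lambda>x. x"] id_isometry by simp
next
  case False
  let ?r = "golden *\<^sub>R (a - b)"
  have r: "?r \<in> BD" using assms False by (rule tight_root)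
  have norm_a: "a \<bullet> a = 1" and v0: "a \<bullet> v0 = 1" "b \<bullet> v0 = 1"
    using assms BD_inner_self unfolding tight_v0[symmetric] by simp_all
  show thesis
  proof (rule that)
    show "mirror ?r \<in> BD_isometries" using r by (rule mirror_isometry)
    show "mirror ?r v0 = v0"
      using v0 by (simp add: mirror_def inner_diff_right inner_commute[of v0])
    have "2 * (a \<bullet> ?r) * golden = 1"
      using tight_inner[OF assms False] norm_a by (simp add: inner_diff_right algebra_simps golden_mult)
    then have "mirror ?r a = a - 1 *\<^sub>R (a - b)"
      unfolding mirror_def scaleR_scaleR by simp
    then show "mirror ?r a = b" by simp
    fix t assume t: "t \<in> {unit_quat, t1, t2, t3}" "t \<noteq> a" "t \<noteq> b"
    then have "t \<bullet> ?r = 0"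
      using tight_inner[OF t(1) assms(1)] tight_inner[OF t(1) assms(2)] by (simp add: inner_diff_right)
    then show "mirror ?r t = t" by (simp add: mirror_def)
  qed
qed

text \<open>
  Two chains of subsets of the four elements, with one element added at each step, correspond
  under an isometry: match them from the smallest set upwards, one swap for each added element.
\<close>

lemma match_chains:
  fixes T U :: "nat \<Rightarrow> quat set"
  assumes T: "\<And>i. i \<le> n \<Longrightarrow> T i \<subseteq> {unit_quat, t1, t2, t3} \<and> card (T i) = i"
    and U: "\<And>i. i \<le> n \<Longrightarrow> U i \<subseteq> {unit_quat, t1, t2, t3} \<and> card (U i) = i"
    and mono: "\<And>i j. i \<le> j \<Longrightarrow> j \<le> n \<Longrightarrow> T i \<subseteq> T j" "\<And>i j. i \<le> j \<Longrightarrow> j \<le> n \<Longrightarrow> U i \<subseteq> U j"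
  shows "\<exists>f\<in>BD_isometries. f v0 = v0 \<and> (\<forall>i\<le>n. f ` T i = U i)"
proof -
  let ?A = "{unit_quat, t1, t2, t3}"
  have "\<exists>f\<in>BD_isometries. f v0 = v0 \<and> (\<forall>i\<le>k. f ` T i = U i)" if "k \<le> n" for k
    using that
  proof (induction k)
    case 0
    have "T 0 = {}" "U 0 = {}"
      using T[of 0] U[of 0] finite_subset[of "T 0" ?A] finite_subset[of "U 0" ?A] by simp_all
    then show ?case using id_isometry by (intro bexI[of _ "\<lambda>x. x"]) simp_all
  next
    case (Suc k)
    then obtain f where f: "f \<in> BD_isometries" "f v0 = v0" "\<And>i. i \<le> k \<Longrightarrow> f ` T i = U i"
      by auto
    have one: "\<exists>a. a \<notin> X k \<and> X (Suc k) = insert a (X k)"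
      if "\<And>i. i \<le> n \<Longrightarrow> X i \<subseteq> ?A \<and> card (X i) = i" "\<And>i j. i \<le> j \<Longrightarrow> j \<le> n \<Longrightarrow> X i \<subseteq> X j" for X :: "nat \<Rightarrow> quat set"
    proof -
      have fin: "finite (X (Suc k))" "finite (X k)"
        using that(1)[of "Suc k"] that(1)[of k] Suc.prems finite_subset[of _ ?A] by simp_all
      have sub: "X k \<subseteq> X (Suc k)" using Suc.prems by (intro that(2)) simp_all
      have "card (X (Suc k) - X k) = 1"
        using that(1)[of "Suc k"] that(1)[of k] Suc.prems card_Diff_subset[OF fin(2) sub] by simp
      then obtain a where "X (Suc k) - X k = {a}" by (rule card_1_singletonE)
      then show ?thesis using sub by blast
    qed
    obtain a where a: "a \<notin> T k" "T (Suc k) = insert a (T k)" using one[OF T mono(1)] by blast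
    obtain b where b: "b \<notin> U k" "U (Suc k) = insert b (U k)" using one[OF U mono(2)] by blast
    have fA: "f t \<in> ?A" if "t \<in> ?A" for t
    proof -
      have "t \<in> BD" "t \<bullet> v0 = 1" using that unfolding tight_v0[symmetric] by simp_all
      then have "f t \<in> BD" "f t \<bullet> v0 = 1"
        using isometry_BD[OF f(1)] isometry_inner[OF f(1), of t v0] f(2) by simp_all
      then show ?thesis unfolding tight_v0[symmetric] by simp
    qed
    have aA: "f a \<in> ?A" using T[of "Suc k"] a(2) Suc.prems by (intro fA) blast
    have bA: "b \<in> ?A" using U[of "Suc k"] b(2) Suc.prems by blast
    obtain g where g: "g \<in> BD_isometries" "g v0 = v0" "g (f a) = b"
      "\<And>t. t \<in> ?A \<Longrightarrow> t \<noteq> f a \<Longrightarrow> t \<noteq> b \<Longrightarrow> g t = t"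
      using tight_swap[OF aA bA] by metis
    have inj: "f x = f y \<longleftrightarrow> x = y" for x y
      using isometry_inverse[OF f(1)] by metis
    have fa: "f a \<notin> U k" using a(1) f(3)[OF order_refl] inj by (metis imageE)
    have fixed: "g t = t" if "t \<in> U k" for t
    proof (rule g(4))
      show "t \<in> ?A" using that U[of k] Suc.prems by (meson Suc_leD subsetD)
      show "t \<noteq> f a" using that fa by metis
      show "t \<noteq> b" using that b(1) by metis
    qed
    have k: "g ` U i = U i" if "i \<le> k" for i
    proof -
      have "U i \<subseteq> U k"
        using \<open>i \<le> k\<close> Suc.prems by (intro mono(2)) simp_all
      then have "g t = t" if "t \<in> U i" for t using that fixed by (meson subsetD)
      then show ?thesis by simp
    qed
    have "(g \<circ> f) ` T i = U i" if "i \<le> Suc k" for i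
    proof (cases "i \<le> k")
      case True
      then show ?thesis unfolding image_comp[symmetric] f(3)[OF True] by (rule k)
    next
      case False
      then have i: "i = Suc k" using that by simp
      show ?thesis
        unfolding i a(2) b(2) image_insert image_comp[symmetric] f(3)[OF order_refl] k[OF order_refl]
          comp_apply g(3) ..
    qed
    then show ?case using comp_isometry[OF g(1) f(1)] f(2) g(2) by (intro bexI[of _ "g \<circ> f"] conjI allI impI) simp_all
  qed
  then show ?thesis by simp
qed

lemma ball_cell:
  assumes "0 < c"
  shows "ball 0 c \<subseteq> cell c"
proof (rule subsetI, rule cellI)
  fix z :: quat and p assume z: "z \<in> ball 0 c" and p: "p \<in> BD"
  have "p \<bullet> z \<le> norm p * norm z" by (rule norm_cauchy_schwarz)
  then show "p \<bullet> z \<le> c" using z BD_norm[OF p] by (simp add: dist_norm)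
qed

lemma interior_cell: "0 < c \<Longrightarrow> interior (cell c) \<noteq> {}"
  using interior_maximal[OF ball_cell open_ball, of c] centre_in_ball[of "0::quat" c] by (metis empty_iff subsetD)

lemma isometry_image_cell:
  assumes "f \<in> BD_isometries"
  shows "f ` cell c = cell c"
proof
  show "f ` cell c \<subseteq> cell c" using isometry_cell[OF assms] by (rule image_subsetI)
  obtain g where g: "g \<in> BD_isometries" "\<And>x. f (g x) = x"
    using isometry_inverse[OF assms] by metis
  show "cell c \<subseteq> f ` cell c"
  proof (rule subsetI)
    fix z assume "z \<in> cell c"
    then have "g z \<in> cell c" by (rule isometry_cell[OF g(1)])
    moreover have "z = f (g z)" using g(2) by simp
    ultimately show "z \<in> f ` cell c" by (rule rev_image_eqI)
  qed
qed

text \<open>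
  A flag has five members. An isometry moves its vertex to \<open>c v0\<close>, and the tight elements of its
  members then form a chain in \<open>{unit_quat, t1, t2, t3}\<close> that shrinks at every step from four
  elements to none, hence by one element at a time.
\<close>

lemma flag_tight_chain:
  assumes c: "0 < c" and flag: "flag_of F (cell c)"
  obtains f and T :: "nat \<Rightarrow> quat set" where "length F = 5" "f \<in> BD_isometries"
    "\<And>i. i \<le> 4 \<Longrightarrow> T i \<subseteq> {unit_quat, t1, t2, t3} \<and> card (T i) = i"
    "\<And>i j. i \<le> j \<Longrightarrow> j \<le> 4 \<Longrightarrow> T i \<subseteq> T j"
    "\<And>l. l \<le> 4 \<Longrightarrow> f ` (F ! l) = {z \<in> cell c. \<forall>p\<in>T (4 - l). p \<bullet> z = c}"
proof -
  have ne: "F \<noteq> []" and last: "last F = cell c" and sorted: "sorted_wrt (\<subset>) F"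
    and faces: "\<And>l. l < length F \<Longrightarrow> F ! l exposed_face_of cell c \<and> aff_dim (F ! l) = int l"
    using flag unfolding flag_of_def by simp_all
  have lastF: "F ! (length F - 1) = cell c" using last_conv_nth[OF ne] last by simp
  have "aff_dim (cell c) = int (length F - 1)"
    using faces[of "length F - 1"] ne lastF by simp
  moreover have "aff_dim (cell c) = 4"
    using aff_dim_nonempty_interior[OF interior_cell[OF c]] by simp
  ultimately have len: "length F = 5" by simp
  have lastF: "F ! 4 = cell c" using lastF len by simp
  obtain z0 where z0: "F ! 0 = {z0}"
    using faces[of 0] len aff_dim_eq_0[of "F ! 0"] by auto
  have "z0 extreme_point_of cell c"
    using faces[of 0] len unfolding z0 exposed_face_of_def face_of_singleton[symmetric] by simp
  then obtain f where f: "f \<in> BD_isometries" "f z0 = c *\<^sub>R v0" using extreme_point_orbit[OF c] by metis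
  define H where "H l = f ` (F ! l)" for l
  define S where "S l = {p \<in> BD. \<forall>x\<in>H l. p \<bullet> x = c}" for l
  have injf: "inj f" using f(1) orthogonal_transformation_inj unfolding BD_isometries_def by blast
  have strict: "F ! l \<subset> F ! m" if "l < m" "m \<le> 4" for l m
    using sorted_wrt_nth_less[OF sorted that(1)] that(2) len by simp
  have Hstrict: "H l \<subset> H m" if "l < m" "m \<le> 4" for l m
    unfolding H_def using strict[OF that] inj_image_subset_iff[OF injf] inj_image_eq_iff[OF injf] by (simp add: psubset_eq)
  have z0_mem: "c *\<^sub>R v0 \<in> H l" if "l \<le> 4" for l
  proof -
    have "z0 \<in> F ! l"
    proof (cases "l = 0")
      case True
      then show ?thesis using z0 by simp
    next
      case False
      then have "{z0} \<subset> F ! l" using strict[of 0 l] that z0 by simp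
      then show ?thesis by (meson insert_subset psubsetE)
    qed
    then show ?thesis unfolding H_def f(2)[symmetric] by (rule imageI)
  qed
  have H_eq: "H l = {z \<in> cell c. \<forall>p\<in>S l. p \<bullet> z = c}" if l: "l \<le> 4" for l
  proof -
    have "F ! l face_of cell c"
      using faces[of l] l len unfolding exposed_face_of_def by simp
    then have "H l face_of cell c"
      unfolding H_def using face_of_linear_image[OF isometry_linear[OF f(1)] injf, of "F ! l" "cell c"]
        isometry_image_cell[OF f(1), of c] by simp
    moreover have "H l \<noteq> {}" using z0_mem[OF l] by (metis empty_iff)
    ultimately show ?thesis
      using face_of_polyhedron_tight[OF finite_BD, of "H l" c] unfolding cell_def S_def by simp
  qed
  have S_A: "S l \<subseteq> {unit_quat, t1, t2, t3}" if "l \<le> 4" for l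
  proof (rule subsetI)
    fix p assume "p \<in> S l"
    then have "p \<in> BD" and tight: "\<And>x. x \<in> H l \<Longrightarrow> p \<bullet> x = c" unfolding S_def by blast+
    moreover have "p \<bullet> c *\<^sub>R v0 = c" using z0_mem[OF that] by (rule tight)
    ultimately show "p \<in> {unit_quat, t1, t2, t3}" unfolding tight_v0[symmetric] using c by simp
  qed
  have S_strict: "S m \<subset> S l" if "l < m" "m \<le> 4" for l m
  proof (rule psubsetI)
    show "S m \<subseteq> S l" using Hstrict[OF that] unfolding S_def by blast
    show "S m \<noteq> S l" using Hstrict[OF that] H_eq[of l] H_eq[of m] that by (metis less_imp_le order_trans psubset_eq)
  qed
  have fin: "finite (S l)" if "l \<le> 4" for l using S_A[OF that] by (rule finite_subset) simp
  have card_less: "card (S m) < card (S l)" if "l < m" "m \<le> 4" for l m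
    using S_strict[OF that] fin[of l] that by (intro psubset_card_mono) simp_all
  have "card (S 0) \<le> 4"
    using card_mono[OF _ S_A[of 0]] card_tight by simp
  moreover note card_less[of 0 1] card_less[of 1 2] card_less[of 2 3] card_less[of 3 4]
  ultimately have cards: "card (S 0) = 4" "card (S 1) = 3" "card (S 2) = 2" "card (S 3) = 1" "card (S 4) = 0"
    by simp_all
  have card_S: "card (S (4 - i)) = i" if "i \<le> 4" for i
  proof -
    have "i = 0 \<or> i = 1 \<or> i = 2 \<or> i = 3 \<or> i = 4" using that by linarith
    then show ?thesis using cards by (elim disjE) simp_all
  qed
  show thesis
  proof (rule that[of f "\<lambda>i. S (4 - i)"])
    show "S (4 - i) \<subseteq> {unit_quat, t1, t2, t3} \<and> card (S (4 - i)) = i" if "i \<le> 4" for i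
      using S_A[of "4 - i"] card_S[OF that] by simp
    show "S (4 - i) \<subseteq> S (4 - j)" if "i \<le> j" "j \<le> 4" for i j
    proof (cases "i = j")
      case False
      then have "S (4 - i) \<subset> S (4 - j)" using that by (intro S_strict) simp_all
      then show ?thesis by simp
    qed simp
    show "f ` (F ! l) = {z \<in> cell c. \<forall>p\<in>S (4 - (4 - l)). p \<bullet> z = c}" if "l \<le> 4" for l
      using H_eq[OF that] that unfolding H_def by simp
  qed (use len f in simp_all)
qed

lemma isometry_Sym:
  assumes "0 < c" and f: "f \<in> BD_isometries"
  shows "f \<in> Sym (cell c)"
proof -
  have UNIV: "affine hull cell c = UNIV"
    using interior_cell[OF assms(1)] by (rule affine_hull_nonempty_interior)
  have "orthogonal_transformation f" using f unfolding BD_isometries_def by simp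
  then have bij: "bij f" by (rule orthogonal_transformation_bij)
  have dist: "dist (f u) (f v) = dist u v" for u v
    unfolding dist_norm linear_diff[OF isometry_linear[OF f], symmetric] using f by (rule isometry_norm)
  show ?thesis
    unfolding Sym_def UNIV
    by (intro CollectI conjI ballI bij dist isometry_image_cell[OF f]) (simp add: extensional_def)
qed

theorem theorem5p7:
  shows "regular_polytope cell120"
proof -
  define c where "c = 1 / norm v0"
  have c: "0 < c" using norm_v0_pos by (simp add: c_def)
  have C: "cell120 = cell c" unfolding c_def by (rule cell120_eq)
  have "\<exists>\<phi>\<in>Sym (cell c). map ((`) \<phi>) F = G" if FG: "flag_of F (cell c)" "flag_of G (cell c)" for F G
  proof -
    obtain f T where F: "length F = 5" "f \<in> BD_isometries"
      "\<And>i. i \<le> 4 \<Longrightarrow> T i \<subseteq> {unit_quat, t1, t2, t3} \<and> card (T i) = i"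
      "\<And>i j. i \<le> j \<Longrightarrow> j \<le> 4 \<Longrightarrow> T i \<subseteq> T j"
      "\<And>l. l \<le> 4 \<Longrightarrow> f ` (F ! l) = {z \<in> cell c. \<forall>p\<in>T (4 - l). p \<bullet> z = c}"
    proof (rule flag_tight_chain[OF c FG(1)], goal_cases)
      case (1 f T)
      show ?case by (rule that[of f T]) (fact 1)+
    qed
    obtain g U where G: "length G = 5" "g \<in> BD_isometries"
      "\<And>i. i \<le> 4 \<Longrightarrow> U i \<subseteq> {unit_quat, t1, t2, t3} \<and> card (U i) = i"
      "\<And>i j. i \<le> j \<Longrightarrow> j \<le> 4 \<Longrightarrow> U i \<subseteq> U j"
      "\<And>l. l \<le> 4 \<Longrightarrow> g ` (G ! l) = {z \<in> cell c. \<forall>p\<in>U (4 - l). p \<bullet> z = c}"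
    proof (rule flag_tight_chain[OF c FG(2)], goal_cases)
      case (1 g U)
      show ?case by (rule that[of g U]) (fact 1)+
    qed
    have "\<exists>h\<in>BD_isometries. h v0 = v0 \<and> (\<forall>i\<le>4. h ` T i = U i)"
      by (rule match_chains; (rule F(3) | rule G(3) | rule F(4) | rule G(4)); assumption)
    then obtain h where h: "h \<in> BD_isometries" "\<And>i. i \<le> 4 \<Longrightarrow> h ` T i = U i"
      by (elim bexE conjE) simp
    obtain k where k: "k \<in> BD_isometries" "\<And>x. k (g x) = x"
      using isometry_inverse[OF G(2)] by metis
    obtain h' where h': "h' \<in> BD_isometries" "\<And>x. h' (h x) = x" "\<And>x. h (h' x) = x"
      using isometry_inverse[OF h(1)] by metis
    have step: "h ` (f ` (F ! l)) = g ` (G ! l)" if l: "l \<le> 4" for l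
    proof -
      have hU: "h ` T (4 - l) = U (4 - l)" by (rule h(2)) simp
      have "h ` {z \<in> cell c. \<forall>p\<in>T (4 - l). p \<bullet> z = c} = {z \<in> cell c. \<forall>p\<in>U (4 - l). p \<bullet> z = c}"
      proof (rule set_eqI, rule iffI)
        fix y assume "y \<in> h ` {z \<in> cell c. \<forall>p\<in>T (4 - l). p \<bullet> z = c}"
        then obtain z where z: "y = h z" "z \<in> cell c" "\<And>p. p \<in> T (4 - l) \<Longrightarrow> p \<bullet> z = c"
          by (elim imageE) simp
        have "h p \<bullet> y = c" if "p \<in> T (4 - l)" for p
          unfolding z(1) isometry_inner[OF h(1)] using that by (rule z(3))
        then show "y \<in> {z \<in> cell c. \<forall>p\<in>U (4 - l). p \<bullet> z = c}"
          unfolding hU[symmetric] z(1) using isometry_cell[OF h(1) z(2)] by simp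
      next
        fix y assume y: "y \<in> {z \<in> cell c. \<forall>p\<in>U (4 - l). p \<bullet> z = c}"
        have "p \<bullet> h' y = c" if "p \<in> T (4 - l)" for p
        proof -
          have "h p \<in> U (4 - l)" using that hU by (metis imageI)
          then have "h p \<bullet> h (h' y) = c" unfolding h'(3) using y by simp
          then show ?thesis unfolding isometry_inner[OF h(1)] .
        qed
        moreover have "h' y \<in> cell c" using y by (intro isometry_cell[OF h'(1)]) simp
        ultimately have "h' y \<in> {z \<in> cell c. \<forall>p\<in>T (4 - l). p \<bullet> z = c}" by simp
        moreover have "y = h (h' y)" using h'(3) by simp
        ultimately show "y \<in> h ` {z \<in> cell c. \<forall>p\<in>T (4 - l). p \<bullet> z = c}" by (rule rev_image_eqI)
      qed
      then show ?thesis unfolding F(5)[OF l] G(5)[OF l] .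
    qed
    define \<phi> where "\<phi> = k \<circ> (h \<circ> f)"
    have "\<phi> \<in> Sym (cell c)"
      unfolding \<phi>_def by (intro isometry_Sym[OF c] comp_isometry k(1) h(1) F(2))
    moreover have "map ((`) \<phi>) F = G"
    proof (rule nth_equalityI)
      show "length (map ((`) \<phi>) F) = length G" using F(1) G(1) by simp
      fix l assume "l < length (map ((`) \<phi>) F)"
      then have l: "l < 5" using F(1) by simp
      have "map ((`) \<phi>) F ! l = k ` (h ` (f ` (F ! l)))"
        using l F(1) by (simp add: \<phi>_def image_comp comp_assoc)
      also have "\<dots> = k ` (g ` (G ! l))" using step[of l] l by simp
      also have "\<dots> = G ! l" using k(2) by (simp add: image_image)
      finally show "map ((`) \<phi>) F ! l = G ! l" .
    qed
    ultimately show ?thesis by (intro bexI[of _ "\<phi>"])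
  qed
  then show ?thesis
    using polytope_cell120 unfolding regular_polytope_def C by blast
qed

end
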